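(* Let $k,n\in\mathbb{Z}_{\ge 1}$ and assume $n\ge 2k$. For $\lambda\in\Lambda_{k,S_n}$ and $\mu=[\mu_1,\mu_2,\dots,\mu_t]\vdash\ell$ with $0\le\ell\le k$, the value of the irreducible character $\xi_\lambda$ of the partition algebra $P_k(n)$ on $\gamma_\mu$ is given by $$\xi_\lambda(\gamma_\mu)=\frac{n^{k-\ell}}{n!}\sum_{\sigma\in S_n}F_\mu(\sigma)\,\chi_\lambda(\sigma^{-1})=\frac{n^{k-\ell}}{n!}\sum_{\sigma\in S_n}F_\mu(\sigma)\,\chi_\lambda(\sigma)=n^{k-\ell}\sum_{\delta\vdash n}\frac{1}{z_\delta}\,F_\mu(\delta)\,\chi_\lambda(\delta).$$
   Context: $\mathbb{F}$ is a field of characteristic zero. $M_n$ is the $n$-dimensional permutation module of $S_n$ over $\mathbb{F}$ with basis $v_1,\dots,v_n$, $\sigma.v_i=v_{\sigma(i)}$; $S_n$ acts diagonally on $M_n^{\otimes k}$. $S_n^\lambda$ is the irreducible $S_n$-module indexed by $\lambda\vdash n$, with character $\chi_\lambda$, and $\Lambda_{k,S_n}$ is the set of $\lambda\vdash n$ such that $S_n^\lambda$ occurs in $M_n^{\otimes k}$. Partition algebra $P_k(n)$: it has $\mathbb{F}$-basis $d_\pi$, with $\pi$ ranging over the set partitions of $\{1,\dots,2k\}$. The diagram $d_\pi$ has two rows of $k$ vertices, bottom vertices labeled $1,\dots,k$ and top vertices labeled $k+1,\dots,2k$, both from left to right, with connected components given by the blocks of $\pi$. The product $d_{\pi_1}d_{\pi_2}$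 is computed by placing $d_{\pi_1}$ above $d_{\pi_2}$, identifying the bottom row of $d_{\pi_1}$ with the top row of $d_{\pi_2}$, deleting connected components lying entirely in the middle row, and multiplying by a factor $n$ for each deleted component. There is an action $\Phi_{k,n}:P_k(n)\to\mathrm{End}_{S_n}(M_n^{\otimes k})$ given by $\Phi_{k,n}(d_\pi)(v_{r_1}\otimes\cdots\otimes v_{r_k})=\sum v_{r_{k+1}}\otimes\cdots\otimes v_{r_{2k}}$, the sum over all $(r_{k+1},\dots,r_{2k})\in\{1,\dots,n\}^k$ such that $r_a=r_b$ whenever $a,b\in\{1,\dots,2k\}$ are in the same block of $\pi$; it is an algebra isomorphism when $n\ge 2k$. For $\lambda\in\Lambda_{k,S_n}$ and $n\ge 2k$, $\xi_\lambda$ is the character of the irreducible $P_k(n)$-module indexed by $\lambda$, namely $\mathrm{Hom}_{S_n}(S_n^\lambda,M_n^{\otimes k})$ with $P_k(n)$ acting by post-composition via $\Phi_{k,n}$. The elements $\gamma_\mu$: for $r\ge1$, $\gamma_r\in P_r(n)$ is the permutation diagram of the $r$-cycle $(1,2,\dots,r)$, in which the bottom vertex in position $i$ is connected to the top vertex in position $i+1$ for $1\le i\le r-1$ and the bottom vertex in position $r$ is connected to the top vertex in position $1$. For a partition $\mu=[\mu_1,\dots,\mu_t]\vdash\ell$ with all $\mu_i>0$ and $0\le\ell\le k$, $\gamma_\mu\in P_k(n)$ is the diagram obtained by juxtaposing from left to right $\gamma_{\mu_1},\dots,\gamma_{\mu_t}$, followed by $k-\ell$ copies of the diagram in $P_1(n)$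 with a top vertex and a bottom vertex not connected to each other. $F(\sigma)$ is the number of fixed points of $\sigma\in S_n$, $F_m(\sigma)=F(\sigma^m)$, and $F_\mu(\sigma)=F_{\mu_1}(\sigma)\cdots F_{\mu_t}(\sigma)$ (equal to $1$ when $\ell=0$). For $\delta\vdash n$ having $d_i$ parts equal to $i$, $z_\delta=1^{d_1}2^{d_2}\cdots n^{d_n}\,d_1!\cdots d_n!$, and $F_\mu(\delta)$, $\chi_\lambda(\delta)$ denote the values of the class functions $F_\mu$, $\chi_\lambda$ on the conjugacy class of permutations of cycle type $\delta$. *)

theory Defs
  imports
    "HOL-Combinatorics.Combinatorics"
    "HOL-Library.Function_Algebras"
    "HOL-Library.Disjoint_Sets"
begin

section \<open>Linear algebra on spaces of functions\<close>

text \<open>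
  The free vector space on a finite set \<open>X\<close> is represented by the functions into the field
  that vanish outside \<open>X\<close>.  Every module below is a subspace (or a space of linear maps
  between subspaces) of such spaces.
\<close>

definition fscale :: "'f::field \<Rightarrow> ('x \<Rightarrow> 'f) \<Rightarrow> 'x \<Rightarrow> 'f" where
  "fscale c f = (\<lambda>x. c * f x)"

definition mapscale :: "'f::field \<Rightarrow> ('v \<Rightarrow> 'y \<Rightarrow> 'f) \<Rightarrow> 'v \<Rightarrow> 'y \<Rightarrow> 'f" where
  "mapscale c \<phi> = (\<lambda>v. fscale c (\<phi> v))"

lemma vector_space_fscale: "vector_space fscale"
  by unfold_locales (auto simp: fscale_def algebra_simps fun_eq_iff)

lemma vector_space_mapscale: "vector_space mapscale"
  by unfold_locales (auto simp: mapscale_def fscale_def algebra_simps fun_eq_iff)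

definition basis_vec :: "'x \<Rightarrow> 'x \<Rightarrow> 'f::field" where
  "basis_vec x = (\<lambda>y. if y = x then 1 else 0)"

text \<open>The linear map on the free vector space on \<open>X\<close> that sends the basis vector of \<open>x\<close> to \<open>g x\<close>.\<close>
definition lin_ext :: "'x set \<Rightarrow> ('x \<Rightarrow> 'y \<Rightarrow> 'f::field) \<Rightarrow> ('x \<Rightarrow> 'f) \<Rightarrow> 'y \<Rightarrow> 'f" where
  "lin_ext X g f = (\<Sum>x\<in>X. fscale (f x) (g x))"

text \<open>
  The trace of an endomorphism \<open>T\<close> of a finite-dimensional subspace \<open>V\<close>, computed in some basis
  of \<open>V\<close>; it does not depend on the choice of the basis.
\<close>
definition trace_on ::
  "('f::field \<Rightarrow> 'v::ab_group_add \<Rightarrow> 'v) \<Rightarrow> 'v set \<Rightarrow> ('v \<Rightarrow> 'v) \<Rightarrow> 'f" where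
  "trace_on scale V T =
     (let B = (SOME B. finite B \<and> \<not> module.dependent scale B \<and> module.span scale B = V)
      in \<Sum>b\<in>B. module.representation scale B (T b) b)"


section \<open>Symmetric groups and partitions of integers\<close>

definition Sym :: "nat \<Rightarrow> (nat \<Rightarrow> nat) set" where
  "Sym n = {\<sigma>. \<sigma> permutes {1..n}}"

definition is_partition :: "nat \<Rightarrow> nat list \<Rightarrow> bool" where
  "is_partition n lam \<longleftrightarrow> sorted_wrt (\<ge>) lam \<and> (\<forall>p\<in>set lam. p > 0) \<and> sum_list lam = n"

definition has_cycle_type :: "nat \<Rightarrow> (nat \<Rightarrow> nat) \<Rightarrow> nat list \<Rightarrow> bool" where
  "has_cycle_type n \<sigma> \<delta> \<longleftrightarrow>
     (\<forall>i\<ge>1. card {C. (\<exists>x\<in>{1..n}. C = orbit \<sigma> x) \<and> card C = i} = count_list \<delta> i)"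

text \<open>The value of a class function on the conjugacy class of cycle type \<open>\<delta>\<close>.\<close>
definition class_value :: "nat \<Rightarrow> ((nat \<Rightarrow> nat) \<Rightarrow> 'a) \<Rightarrow> nat list \<Rightarrow> 'a" where
  "class_value n f \<delta> = (THE c. \<forall>\<sigma>\<in>Sym n. has_cycle_type n \<sigma> \<delta> \<longrightarrow> f \<sigma> = c)"

definition zee :: "nat \<Rightarrow> nat list \<Rightarrow> nat" where
  "zee n \<delta> = (\<Prod>i=1..n. i ^ count_list \<delta> i * fact (count_list \<delta> i))"

definition fixpts :: "nat \<Rightarrow> (nat \<Rightarrow> nat) \<Rightarrow> nat" where
  "fixpts n \<sigma> = card {i\<in>{1..n}. \<sigma> i = i}"

definition fixpts_part :: "nat \<Rightarrow> nat list \<Rightarrow> (nat \<Rightarrow> nat) \<Rightarrow> nat" where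
  "fixpts_part n mu \<sigma> = (\<Prod>m\<leftarrow>mu. fixpts n (\<sigma> ^^ m))"


section \<open>The irreducible modules of the symmetric group\<close>

text \<open>
  The irreducible module indexed by \<open>lam\<close> is James' Specht module, the span of the polytabloids
  in the permutation module on tabloids of shape \<open>lam\<close> (so that the one-row partition gives the
  trivial module).  A tabloid is the list of the row sets of a tableau.
\<close>

definition cells :: "nat list \<Rightarrow> (nat \<times> nat) set" where
  "cells lam = {(i, j). i < length lam \<and> j < lam ! i}"

definition tableau :: "nat \<Rightarrow> nat list \<Rightarrow> (nat \<times> nat \<Rightarrow> nat) \<Rightarrow> bool" where
  "tableau n lam t \<longleftrightarrow> bij_betw t (cells lam) {1..n}"

definition tabloid :: "nat list \<Rightarrow> (nat \<times> nat \<Rightarrow> nat) \<Rightarrow> nat set list" where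
  "tabloid lam t = map (\<lambda>i. {t (i, j) | j. j < lam ! i}) [0..<length lam]"

definition tabloids :: "nat \<Rightarrow> nat list \<Rightarrow> nat set list set" where
  "tabloids n lam = {tabloid lam t | t. tableau n lam t}"

definition column :: "nat list \<Rightarrow> (nat \<times> nat \<Rightarrow> nat) \<Rightarrow> nat \<Rightarrow> nat set" where
  "column lam t j = {t (i, j) | i. (i, j) \<in> cells lam}"

definition col_stab :: "nat \<Rightarrow> nat list \<Rightarrow> (nat \<times> nat \<Rightarrow> nat) \<Rightarrow> (nat \<Rightarrow> nat) set" where
  "col_stab n lam t = {\<sigma>\<in>Sym n. \<forall>j. \<sigma> ` column lam t j = column lam t j}"

definition polytabloid ::
  "nat \<Rightarrow> nat list \<Rightarrow> (nat \<times> nat \<Rightarrow> nat) \<Rightarrow> nat set list \<Rightarrow> 'f::field_char_0" where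
  "polytabloid n lam t =
     (\<Sum>\<sigma>\<in>col_stab n lam t.
        fscale (of_int (sign \<sigma>)) (basis_vec (map (image \<sigma>) (tabloid lam t))))"

definition specht :: "nat \<Rightarrow> nat list \<Rightarrow> (nat set list \<Rightarrow> 'f::field_char_0) set" where
  "specht n lam = module.span fscale {polytabloid n lam t | t. tableau n lam t}"

definition specht_act ::
  "nat \<Rightarrow> nat list \<Rightarrow> (nat \<Rightarrow> nat) \<Rightarrow> (nat set list \<Rightarrow> 'f::field_char_0) \<Rightarrow> nat set list \<Rightarrow> 'f" where
  "specht_act n lam \<sigma> = lin_ext (tabloids n lam) (\<lambda>T. basis_vec (map (image \<sigma>) T))"

definition chi :: "nat \<Rightarrow> nat list \<Rightarrow> (nat \<Rightarrow> nat) \<Rightarrow> 'f::field_char_0" where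
  "chi n lam \<sigma> = trace_on fscale (specht n lam) (specht_act n lam \<sigma>)"


section \<open>Tensor powers of the permutation module\<close>

text \<open>
  The \<open>k\<close>-th tensor power of the permutation module has the basis
  \<open>v_{r_1} \<otimes> \<dots> \<otimes> v_{r_k}\<close>, indexed by the lists \<open>[r_1, \<dots>, r_k]\<close> over \<open>{1..n}\<close>.
\<close>

definition tuples :: "nat \<Rightarrow> nat \<Rightarrow> nat list set" where
  "tuples n k = {r. length r = k \<and> set r \<subseteq> {1..n}}"

definition tensor_power :: "nat \<Rightarrow> nat \<Rightarrow> (nat list \<Rightarrow> 'f::field_char_0) set" where
  "tensor_power n k = {f. \<forall>r. r \<notin> tuples n k \<longrightarrow> f r = 0}"

definition tensor_act ::
  "nat \<Rightarrow> nat \<Rightarrow> (nat \<Rightarrow> nat) \<Rightarrow> (nat list \<Rightarrow> 'f::field_char_0) \<Rightarrow> nat list \<Rightarrow> 'f" where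
  "tensor_act n k \<sigma> = lin_ext (tuples n k) (\<lambda>r. basis_vec (map \<sigma> r))"

text \<open>
  Equivariant linear maps from the Specht module to the tensor power.  A map defined on the Specht
  module only is represented by its extension by zero, which makes these maps a vector space
  under \<^term>\<open>mapscale\<close>.
\<close>
definition hom_specht ::
  "nat \<Rightarrow> nat \<Rightarrow> nat list \<Rightarrow> ((nat set list \<Rightarrow> 'f::field_char_0) \<Rightarrow> nat list \<Rightarrow> 'f) set" where
  "hom_specht n k lam = {\<phi>.
     (\<forall>v\<in>specht n lam. \<phi> v \<in> tensor_power n k) \<and>
     (\<forall>v\<in>specht n lam. \<forall>w\<in>specht n lam. \<phi> (v + w) = \<phi> v + \<phi> w) \<and>
     (\<forall>c. \<forall>v\<in>specht n lam. \<phi> (fscale c v) = fscale c (\<phi> v)) \<and>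
     (\<forall>\<sigma>\<in>Sym n. \<forall>v\<in>specht n lam. \<phi> (specht_act n lam \<sigma> v) = tensor_act n k \<sigma> (\<phi> v)) \<and>
     (\<forall>v. v \<notin> specht n lam \<longrightarrow> \<phi> v = 0)}"

text \<open>The partitions whose irreducible module embeds into the tensor power over the field \<open>'f\<close>.\<close>
definition Lambda :: "'f::field_char_0 itself \<Rightarrow> nat \<Rightarrow> nat \<Rightarrow> nat list set" where
  "Lambda F n k = {lam. is_partition n lam \<and>
     (\<exists>\<phi>\<in>hom_specht n k lam. inj_on \<phi> (specht n lam :: (nat set list \<Rightarrow> 'f) set))}"


section \<open>The partition algebra\<close>

definition partition_algebra :: "nat \<Rightarrow> (nat set set \<Rightarrow> 'f::field_char_0) set" where
  "partition_algebra k = {a. \<forall>\<pi>. \<not> partition_on {1..2*k} \<pi> \<longrightarrow> a \<pi> = 0}"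

definition dgm :: "nat set set \<Rightarrow> nat set set \<Rightarrow> 'f::field_char_0" where
  "dgm \<pi> = basis_vec \<pi>"

text \<open>
  Placing \<open>\<pi>\<^sub>1\<close> above \<open>\<pi>\<^sub>2\<close> gives a diagram on three rows: \<open>1..k\<close> at the bottom, \<open>k+1..2k\<close> in the
  middle and \<open>2k+1..3k\<close> on top.
\<close>
definition stack_components :: "nat \<Rightarrow> nat set set \<Rightarrow> nat set set \<Rightarrow> nat set set" where
  "stack_components k \<pi>\<^sub>1 \<pi>\<^sub>2 =
     {1..3*k} // ((\<Union>B \<in> image (\<lambda>i. i + k) ` \<pi>\<^sub>1 \<union> \<pi>\<^sub>2. B \<times> B)\<^sup>+)"

definition stack_loops :: "nat \<Rightarrow> nat set set \<Rightarrow> nat set set \<Rightarrow> nat" where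
  "stack_loops k \<pi>\<^sub>1 \<pi>\<^sub>2 = card {C \<in> stack_components k \<pi>\<^sub>1 \<pi>\<^sub>2. C \<subseteq> {k+1..2*k}}"

definition stack_diagram :: "nat \<Rightarrow> nat set set \<Rightarrow> nat set set \<Rightarrow> nat set set" where
  "stack_diagram k \<pi>\<^sub>1 \<pi>\<^sub>2 =
     (\<lambda>C. (\<lambda>i. if i \<le> k then i else i - k) ` (C - {k+1..2*k}))
       ` {C \<in> stack_components k \<pi>\<^sub>1 \<pi>\<^sub>2. \<not> C \<subseteq> {k+1..2*k}}"

definition partition_mult ::
  "nat \<Rightarrow> nat \<Rightarrow> (nat set set \<Rightarrow> 'f::field_char_0) \<Rightarrow> (nat set set \<Rightarrow> 'f) \<Rightarrow> nat set set \<Rightarrow> 'f" where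
  "partition_mult n k a b =
     (\<Sum>\<pi>\<^sub>1 | partition_on {1..2*k} \<pi>\<^sub>1. \<Sum>\<pi>\<^sub>2 | partition_on {1..2*k} \<pi>\<^sub>2.
        fscale (a \<pi>\<^sub>1 * b \<pi>\<^sub>2 * of_nat n ^ stack_loops k \<pi>\<^sub>1 \<pi>\<^sub>2) (dgm (stack_diagram k \<pi>\<^sub>1 \<pi>\<^sub>2)))"

definition constant_on_blocks :: "nat set set \<Rightarrow> nat list \<Rightarrow> bool" where
  "constant_on_blocks \<pi> w \<longleftrightarrow> (\<forall>B\<in>\<pi>. \<forall>a\<in>B. \<forall>b\<in>B. w ! (a - 1) = w ! (b - 1))"

text \<open>
  The action of a diagram on the tensor power; the label \<open>a\<close> of a vertex corresponds to the position
  \<open>a - 1\<close> in the list \<open>r @ s\<close>.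
\<close>
definition Phi_dgm ::
  "nat \<Rightarrow> nat \<Rightarrow> nat set set \<Rightarrow> (nat list \<Rightarrow> 'f::field_char_0) \<Rightarrow> nat list \<Rightarrow> 'f" where
  "Phi_dgm n k \<pi> = lin_ext (tuples n k)
     (\<lambda>r. \<Sum>s | s \<in> tuples n k \<and> constant_on_blocks \<pi> (r @ s). basis_vec s)"

definition Phi ::
  "nat \<Rightarrow> nat \<Rightarrow> (nat set set \<Rightarrow> 'f::field_char_0) \<Rightarrow> (nat list \<Rightarrow> 'f) \<Rightarrow> nat list \<Rightarrow> 'f" where
  "Phi n k a f = (\<Sum>\<pi> | partition_on {1..2*k} \<pi>. fscale (a \<pi>) (Phi_dgm n k \<pi> f))"

text \<open>
  The character of the partition algebra on \<^term>\<open>hom_specht n k lam\<close>, on which an element \<open>a\<close> acts by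
  post-composition with \<^term>\<open>Phi n k a\<close>.
\<close>
definition xi :: "nat \<Rightarrow> nat \<Rightarrow> nat list \<Rightarrow> (nat set set \<Rightarrow> 'f::field_char_0) \<Rightarrow> 'f" where
  "xi n k lam a = trace_on mapscale (hom_specht n k lam) (\<lambda>\<phi>. Phi n k a \<circ> \<phi>)"


section \<open>The diagrams \<open>\<gamma>\<close>\<close>

text \<open>
  A diagram together with its number of columns; juxtaposition shifts the vertices so that the
  bottom vertices of the result are again \<open>1..a+b\<close> and its top vertices \<open>a+b+1..2(a+b)\<close>.
\<close>
fun juxtapose :: "nat \<times> nat set set \<Rightarrow> nat \<times> nat set set \<Rightarrow> nat \<times> nat set set" where
  "juxtapose (a, \<pi>) (b, \<rho>) =
     (a + b,
      image (\<lambda>i. if i \<le> a then i else i + b) ` \<pi> \<union>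
      image (\<lambda>i. if i \<le> b then i + a else i + 2 * a) ` \<rho>)"

definition cycle_dgm :: "nat \<Rightarrow> nat set set" where
  "cycle_dgm r = {{i, r + (i + 1)} | i. 1 \<le> i \<and> i < r} \<union> {{r, r + 1}}"

definition gamma_dgm :: "nat \<Rightarrow> nat list \<Rightarrow> nat set set" where
  "gamma_dgm k mu = snd (foldr juxtapose
     (map (\<lambda>r. (r, cycle_dgm r)) mu @ replicate (k - sum_list mu) (1, {{1}, {2}})) (0, {}))"

end

theory Submission
  imports Defs
begin

text \<open>
  Write \<open>V\<close> for the Specht module of \<open>\<lambda>\<close>, \<open>W\<close> for the tensor power \<open>M\<^sub>n\<^sup>\<otimes>\<^sup>k\<close> and \<open>G\<close> for \<open>S\<^sub>n\<close>.
  The idea is that averaging over \<open>G\<close> projects \<open>Hom(V, W)\<close> onto \<open>Hom\<^sub>G(V, W)\<close>.  Hence, for every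
  endomorphism \<open>A\<close> of \<open>W\<close> that commutes with \<open>G\<close>, the trace of \<open>\<phi> \<mapsto> A \<circ> \<phi>\<close> on \<open>Hom\<^sub>G(V, W)\<close> is the
  trace of \<open>\<phi> \<mapsto> (1/n!) \<Sum>\<^sub>\<sigma> A \<sigma> \<phi> \<sigma>\<^sup>-\<^sup>1\<close> on the whole of \<open>Hom(V, W) = W \<otimes> V\<^sup>*\<close>, which is
  \<open>(1/n!) \<Sum>\<^sub>\<sigma> tr\<^sub>W(A \<sigma>) \<chi>\<^sub>\<lambda>(\<sigma>\<^sup>-\<^sup>1)\<close> (lemma \<open>trace_on_hom_specht\<close>).  For the diagram \<open>A = \<gamma>\<^sub>\<mu>\<close>, the trace
  \<open>tr\<^sub>W(A \<sigma>)\<close> counts the words \<open>r\<close> for which the bottom row \<open>\<sigma> r\<close> and the top row \<open>r\<close> are together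
  constant on the blocks.  A juxtaposed diagram constrains the pieces of the word independently; an
  \<open>m\<close>-cycle forces the word \<open>x, \<sigma> x, \<sigma>\<^sup>2 x, \<dots>\<close> with \<open>\<sigma>\<^sup>m x = x\<close>, and a pair of isolated vertices
  forces nothing.  So the trace is \<open>n\<^sup>k\<^sup>-\<^sup>\<ell> F\<^sub>\<mu>(\<sigma>)\<close> (lemma \<open>card_twisted_fixed_words_gamma\<close>), which gives
  the first formula.

  The second formula is the substitution \<open>\<sigma> \<mapsto> \<sigma>\<^sup>-\<^sup>1\<close>, since a power of \<open>\<sigma>\<close> and its inverse have the
  same fixed points.  The third one groups the permutations by cycle type: permutations of the same
  cycle type are conjugate (\<open>cycle_class_conjugate\<close>), \<open>F\<^sub>\<mu>\<close> and \<open>\<chi>\<^sub>\<lambda>\<close> are class functions, and the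
  class of cycle type \<open>\<delta>\<close> has \<open>n! / z\<^sub>\<delta>\<close> elements (\<open>card_cycle_class\<close>).  Both facts about cycle types
  are proved by splitting off one cycle.
\<close>

section \<open>Traces computed in a dual frame\<close>

text \<open>
  Additivity and homogeneity are asked on \<open>V\<close> only: the maps that occur below (coordinates in a
  basis of \<open>V\<close>, equivariant maps extended by zero) are not linear on the whole space.
\<close>
definition linear_on ::
  "('a \<Rightarrow> 'v \<Rightarrow> 'v) \<Rightarrow> ('a \<Rightarrow> 'w \<Rightarrow> 'w) \<Rightarrow> 'v::plus set \<Rightarrow> ('v \<Rightarrow> 'w::plus) \<Rightarrow> bool" where
  "linear_on scl scl' V g \<longleftrightarrow>
     (\<forall>v\<in>V. \<forall>w\<in>V. g (v + w) = g v + g w) \<and> (\<forall>c. \<forall>v\<in>V. g (scl c v) = scl' c (g v))"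

lemma (in vector_space) linear_on_sum:
  fixes g :: "'b \<Rightarrow> 'w::ab_group_add"
  assumes "subspace V" "linear_on scale scl' V g" "\<And>i. i \<in> I \<Longrightarrow> u i \<in> V"
  shows "g (\<Sum>i\<in>I. scale (c i) (u i)) = (\<Sum>i\<in>I. scl' (c i) (g (u i)))"
proof -
  have zero: "g 0 = 0"
    using assms(1,2) subspace_0[of V] unfolding linear_on_def
    by (metis add_cancel_right_left)
  show ?thesis
    using assms(3)
  proof (induction I rule: infinite_finite_induct)
    case (insert i I)
    have "(\<Sum>i\<in>I. scale (c i) (u i)) \<in> V" "scale (c i) (u i) \<in> V"
      using insert.prems assms(1) by (auto intro!: subspace_sum subspace_scale)
    then show ?case
      using insert assms(2) by (simp add: linear_on_def)
  qed (auto simp: zero)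
qed

lemma (in vector_space) finite_basis_of_span:
  assumes "finite S"
  obtains B where "finite B" "\<not> dependent B" "span B = span S"
proof -
  obtain B where B: "B \<subseteq> S" "independent B" "S \<subseteq> span B"
    using maximal_independent_subset[of S] by blast
  then have "span B = span S"
    by (metis span_eq span_superset subset_trans)
  with B assms show ?thesis
    using that finite_subset by blast
qed

text \<open>
  The trace is defined through some choice of a basis; this is the only place where the choice is
  opened.  It matters that a finite basis exists at all, which a finite spanning set guarantees.
\<close>
lemma (in vector_space) trace_on_basis:
  assumes "finite S" "span S = V"
  obtains B where "finite B" "\<not> dependent B" "span B = V"
    "\<And>T. trace_on scale V T = (\<Sum>b\<in>B. representation B (T b) b)"
proof -
  let ?P = "\<lambda>B. finite B \<and> \<not> dependent B \<and> span B = V"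
  have "\<exists>B. ?P B"
    using assms finite_basis_of_span by metis
  then have "?P (SOME B. ?P B)"
    by (rule someI_ex)
  then show ?thesis
    using that by (auto simp: trace_on_def Let_def)
qed

text \<open>
  A frame with its dual functionals need not be a basis: expanding the vectors \<open>b\<close> of the hidden
  basis in the frame and collecting the coordinates of \<open>T (u i)\<close> turns \<open>\<Sum>\<^sub>b b\<^sup>*(T b)\<close> into
  \<open>\<Sum>\<^sub>i f i (T (u i))\<close>.  This freedom replaces both independence of the basis and the passage from
  \<open>Hom(V, W)\<close> to its invariants: the projections of a basis form a frame of the image.
\<close>
lemma (in vector_space) trace_on_frame:
  assumes "finite I" and V: "subspace V" and u: "\<And>i. i \<in> I \<Longrightarrow> u i \<in> V"
    and f: "\<And>i. i \<in> I \<Longrightarrow> linear_on scale (*) V (f i)"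
    and frame: "\<And>v. v \<in> V \<Longrightarrow> v = (\<Sum>i\<in>I. scale (f i v) (u i))"
    and T: "linear_on scale scale V T" "\<And>v. v \<in> V \<Longrightarrow> T v \<in> V"
  shows "trace_on scale V T = (\<Sum>i\<in>I. f i (T (u i)))"
proof -
  have "span (u ` I) = V"
  proof
    show "span (u ` I) \<subseteq> V"
      using u V by (intro span_minimal) auto
    show "V \<subseteq> span (u ` I)"
    proof
      fix v assume "v \<in> V"
      have "(\<Sum>i\<in>I. scale (f i v) (u i)) \<in> span (u ` I)"
        by (intro span_sum span_scale span_base) auto
      then show "v \<in> span (u ` I)"
        using frame[OF \<open>v \<in> V\<close>] by simp
    qed
  qed
  moreover have "finite (u ` I)"
    using \<open>finite I\<close> by simp
  ultimately obtain B where B: "finite B" "\<not> dependent B" "span B = V"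
      and tr: "\<And>T. trace_on scale V T = (\<Sum>b\<in>B. representation B (T b) b)"
    using trace_on_basis by metis
  have BV: "b \<in> V" if "b \<in> B" for b
    using B(3) that span_base by blast
  have rep: "representation B (\<Sum>i\<in>I. scale (c i) (T (u i))) b
      = (\<Sum>i\<in>I. c i * representation B (T (u i)) b)" for c b
    using B u T(2) by (subst representation_sum) (auto simp: representation_scale span_scale)
  have "trace_on scale V T = (\<Sum>b\<in>B. \<Sum>i\<in>I. f i b * representation B (T (u i)) b)"
    unfolding tr
  proof (rule sum.cong)
    fix b assume b: "b \<in> B"
    have "T b = T (\<Sum>i\<in>I. scale (f i b) (u i))"
      using frame[OF BV[OF b]] by simp
    also have "\<dots> = (\<Sum>i\<in>I. scale (f i b) (T (u i)))"
      using V T(1) u by (rule linear_on_sum)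
    finally show "representation B (T b) b = (\<Sum>i\<in>I. f i b * representation B (T (u i)) b)"
      by (simp add: rep)
  qed simp
  also have "\<dots> = (\<Sum>i\<in>I. \<Sum>b\<in>B. representation B (T (u i)) b * f i b)"
    by (subst sum.swap) (simp add: mult.commute)
  also have "\<dots> = (\<Sum>i\<in>I. f i (\<Sum>b\<in>B. scale (representation B (T (u i)) b) b))"
    by (intro sum.cong refl linear_on_sum[OF V f BV, symmetric])
  also have "\<dots> = (\<Sum>i\<in>I. f i (T (u i)))"
    using B u T(2) by (intro sum.cong) (auto simp: sum_representation_eq)
  finally show ?thesis .
qed

section \<open>Permutation modules and Specht modules\<close>

interpretation fn: vector_space "fscale :: 'f::field \<Rightarrow> ('x \<Rightarrow> 'f) \<Rightarrow> 'x \<Rightarrow> 'f"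
  by (rule vector_space_fscale)

interpretation mp: vector_space "mapscale :: 'f::field \<Rightarrow> ('v \<Rightarrow> 'y \<Rightarrow> 'f) \<Rightarrow> 'v \<Rightarrow> 'y \<Rightarrow> 'f"
  by (rule vector_space_mapscale)

lemma sum_fun_apply: "(\<Sum>i\<in>I. g i) x = (\<Sum>i\<in>I. g i x)"
  by (induction I rule: infinite_finite_induct) auto

lemma lin_ext_apply: "lin_ext X g f y = (\<Sum>x\<in>X. f x * g x y)"
  by (simp add: lin_ext_def sum_fun_apply fscale_def)

lemma linear_on_lin_ext: "linear_on fscale fscale V (lin_ext X g)"
  by (simp add: linear_on_def fun_eq_iff lin_ext_apply fscale_def algebra_simps
      sum.distrib sum_distrib_left)

lemma lin_ext_basis_vec:
  assumes "finite X" "x \<in> X"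
  shows "lin_ext X g (basis_vec x) = g x"
proof
  fix y
  have "lin_ext X g (basis_vec x) y = (\<Sum>x'\<in>X. if x' = x then g x y else 0)"
    unfolding lin_ext_apply basis_vec_def by (intro sum.cong) auto
  then show "lin_ext X g (basis_vec x) y = g x y"
    using assms by simp
qed

text \<open>
  Permuting a basis by \<open>h\<close> substitutes \<open>h\<^sup>-\<^sup>1\<close> in the coordinate function; the group laws for
  both actions below are read off from this form.
\<close>
lemma lin_ext_permutation:
  assumes "finite X" "\<And>x. x \<in> X \<Longrightarrow> h x \<in> X \<and> h' (h x) = x"
    "\<And>x. x \<in> X \<Longrightarrow> h' x \<in> X \<and> h (h' x) = x"
  shows "lin_ext X (\<lambda>x. basis_vec (h x)) f = (\<lambda>y. if y \<in> X then f (h' y) else 0)"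
proof
  fix y
  have "lin_ext X (\<lambda>x. basis_vec (h x)) f y = (\<Sum>x\<in>X. if y = h x then f x else 0)"
    unfolding lin_ext_apply basis_vec_def by (intro sum.cong) auto
  also have "\<dots> = (if y \<in> X then f (h' y) else 0)"
  proof (cases "y \<in> X")
    case True
    have "(\<Sum>x\<in>X. if y = h x then f x else 0) = (\<Sum>x\<in>X. if x = h' y then f x else 0)"
      using assms True by (intro sum.cong) auto
    then show ?thesis
      using assms True by simp
  next
    case False
    then show ?thesis
      using assms by (auto intro!: sum.neutral)
  qed
  finally show "lin_ext X (\<lambda>x. basis_vec (h x)) f y = (if y \<in> X then f (h' y) else 0)" .
qed

lemma card_Sym: "card (Sym n) = fact n"
  unfolding Sym_def by (subst card_permutations[of _ n]) auto

lemma Sym_inv: "\<sigma> \<in> Sym n \<Longrightarrow> inv \<sigma> \<in> Sym n"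
  by (simp add: Sym_def permutes_inv)

lemma Sym_comp: "\<sigma> \<in> Sym n \<Longrightarrow> \<tau> \<in> Sym n \<Longrightarrow> \<sigma> \<circ> \<tau> \<in> Sym n"
  by (simp add: Sym_def permutes_compose)

lemma Sym_inverses:
  assumes "\<sigma> \<in> Sym n"
  shows "\<sigma> (inv \<sigma> x) = x" "inv \<sigma> (\<sigma> x) = x" "\<sigma> \<circ> inv \<sigma> = id" "inv \<sigma> \<circ> \<sigma> = id" "inv (inv \<sigma>) = \<sigma>"
  using assms unfolding Sym_def
  by (auto simp: permutes_inverses permutes_inv_o permutes_inv_inv)

lemma Sym_image: "\<sigma> \<in> Sym n \<Longrightarrow> \<sigma> ` {1..n} = {1..n}"
  by (simp add: Sym_def permutes_image)

lemma finite_tuples: "finite (tuples n k)"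
  using finite_lists_length_eq[of "{1..n}" k] by (simp add: tuples_def conj_commute)

lemma tuples_map: "\<sigma> \<in> Sym n \<Longrightarrow> r \<in> tuples n k \<Longrightarrow> map \<sigma> r \<in> tuples n k"
  using Sym_image[of \<sigma> n] by (auto simp: tuples_def)

lemma tensor_act_apply:
  assumes "\<sigma> \<in> Sym n"
  shows "tensor_act n k \<sigma> f = (\<lambda>s. if s \<in> tuples n k then f (map (inv \<sigma>) s) else 0)"
  unfolding tensor_act_def
  by (rule lin_ext_permutation)
    (auto simp: finite_tuples tuples_map assms Sym_inv Sym_inverses[OF assms] comp_def)

lemma tabloid_comp: "map (image \<sigma>) (tabloid lam t) = tabloid lam (\<sigma> \<circ> t)"
  by (auto simp: tabloid_def)

lemma tableau_comp: "\<sigma> \<in> Sym n \<Longrightarrow> tableau n lam t \<Longrightarrow> tableau n lam (\<sigma> \<circ> t)"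
  unfolding tableau_def Sym_def by (auto intro: bij_betw_trans permutes_imp_bij)

lemma tabloids_map: "\<sigma> \<in> Sym n \<Longrightarrow> T \<in> tabloids n lam \<Longrightarrow> map (image \<sigma>) T \<in> tabloids n lam"
  by (auto simp: tabloids_def tabloid_comp intro: tableau_comp)

lemma tabloid_in: "tableau n lam t \<Longrightarrow> tabloid lam t \<in> tabloids n lam"
  by (auto simp: tabloids_def)

lemma finite_tabloids: "finite (tabloids n lam)"
proof (rule finite_subset)
  show "tabloids n lam \<subseteq> {T. set T \<subseteq> Pow {1..n} \<and> length T = length lam}"
  proof (clarsimp simp: tabloids_def tabloid_def tableau_def bij_betw_def)
    fix t i j
    assume "t ` cells lam = {Suc 0..n}" "i < length lam" "j < lam ! i"
    then have "t (i, j) \<in> {Suc 0..n}"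
      by (metis (mono_tags) cells_def imageI case_prodI mem_Collect_eq)
    then show "Suc 0 \<le> t (i, j) \<and> t (i, j) \<le> n"
      by simp
  qed
  show "finite {T. set T \<subseteq> Pow {1..n} \<and> length T = length lam}"
    by (rule finite_lists_length_eq) simp
qed

lemma specht_act_apply:
  assumes "\<sigma> \<in> Sym n"
  shows "specht_act n lam \<sigma> f =
    (\<lambda>T. if T \<in> tabloids n lam then f (map (image (inv \<sigma>)) T) else 0)"
  unfolding specht_act_def
  by (rule lin_ext_permutation)
    (auto simp: finite_tabloids tabloids_map assms Sym_inv image_comp Sym_inverses[OF assms] comp_def)

lemma column_comp: "column lam (\<sigma> \<circ> t) j = \<sigma> ` column lam t j"
  by (auto simp: column_def)

lemma col_stab_Sym: "\<tau> \<in> col_stab n lam t \<Longrightarrow> \<tau> \<in> Sym n"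
  by (simp add: col_stab_def)

lemma sign_conjugate:
  assumes "\<sigma> \<in> Sym n" "\<tau> \<in> Sym n"
  shows "sign (\<sigma> \<circ> \<tau> \<circ> inv \<sigma>) = sign \<tau>"
proof -
  have "permutation \<sigma>" "permutation \<tau>" "permutation (inv \<sigma>)"
    using assms Sym_inv[of \<sigma> n] unfolding Sym_def by (auto intro: permutation_permutes[THEN iffD2])
  then show ?thesis
    by (simp add: sign_compose permutation_compose sign_inverse sign_idempotent mult.commute
        mult.left_commute)
qed

lemma col_stab_conjugate:
  assumes \<sigma>: "\<sigma> \<in> Sym n" and "\<tau> \<in> col_stab n lam t"
  shows "\<sigma> \<circ> \<tau> \<circ> inv \<sigma> \<in> col_stab n lam (\<sigma> \<circ> t)"
proof -
  have "\<sigma> ` \<tau> ` inv \<sigma> ` \<sigma> ` column lam t j = \<sigma> ` column lam t j" for j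
    using assms(2) by (simp add: image_comp Sym_inverses[OF \<sigma>] col_stab_def)
  then show ?thesis
    using assms by (simp add: col_stab_def column_comp Sym_comp Sym_inv image_comp comp_assoc)
qed

text \<open>
  Conjugation by \<open>\<sigma>\<close> carries the column stabilizer of \<open>t\<close> to that of \<open>\<sigma> \<circ> t\<close> and preserves signs,
  so the two alternating sums agree term by term.  This is why the Specht module is a submodule.
\<close>
lemma specht_act_polytabloid:
  assumes \<sigma>: "\<sigma> \<in> Sym n" and t: "tableau n lam t"
  shows "specht_act n lam \<sigma> (polytabloid n lam t) = polytabloid n lam (\<sigma> \<circ> t)"
proof -
  have "specht_act n lam \<sigma> (polytabloid n lam t) = (\<Sum>\<tau>\<in>col_stab n lam t.
      fscale (of_int (sign \<tau>)) (specht_act n lam \<sigma> (basis_vec (map (image \<tau>) (tabloid lam t)))))"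
    unfolding polytabloid_def
    by (rule fn.linear_on_sum[where V = UNIV]) (auto simp: specht_act_def linear_on_lin_ext)
  also have "\<dots> = (\<Sum>\<tau>\<in>col_stab n lam t.
      fscale (of_int (sign \<tau>)) (basis_vec (tabloid lam (\<sigma> \<circ> \<tau> \<circ> t))))"
    by (intro sum.cong refl)
      (simp add: specht_act_def tabloid_comp t col_stab_Sym tabloid_in tableau_comp
        lin_ext_basis_vec finite_tabloids comp_assoc)
  also have "\<dots> = polytabloid n lam (\<sigma> \<circ> t)"
    unfolding polytabloid_def
  proof (rule sum.reindex_bij_witness[where i = "\<lambda>\<tau>. inv \<sigma> \<circ> \<tau> \<circ> \<sigma>" and j = "\<lambda>\<tau>. \<sigma> \<circ> \<tau> \<circ> inv \<sigma>"])
    fix \<tau> assume \<tau>: "\<tau> \<in> col_stab n lam t"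
    show "inv \<sigma> \<circ> (\<sigma> \<circ> \<tau> \<circ> inv \<sigma>) \<circ> \<sigma> = \<tau>"
      by (simp add: fun_eq_iff Sym_inverses[OF \<sigma>])
    show "\<sigma> \<circ> \<tau> \<circ> inv \<sigma> \<in> col_stab n lam (\<sigma> \<circ> t)"
      using \<sigma> \<tau> by (rule col_stab_conjugate)
    have "\<sigma> \<circ> \<tau> \<circ> inv \<sigma> \<circ> (\<sigma> \<circ> t) = \<sigma> \<circ> \<tau> \<circ> t"
      by (simp add: fun_eq_iff Sym_inverses[OF \<sigma>])
    then show "fscale (of_int (sign (\<sigma> \<circ> \<tau> \<circ> inv \<sigma>)))
        (basis_vec (map ((`) (\<sigma> \<circ> \<tau> \<circ> inv \<sigma>)) (tabloid lam (\<sigma> \<circ> t))))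
      = fscale (of_int (sign \<tau>)) (basis_vec (tabloid lam (\<sigma> \<circ> \<tau> \<circ> t)))"
      by (simp only: tabloid_comp sign_conjugate[OF \<sigma> col_stab_Sym[OF \<tau>]])
  next
    fix \<tau> assume \<tau>: "\<tau> \<in> col_stab n lam (\<sigma> \<circ> t)"
    show "\<sigma> \<circ> (inv \<sigma> \<circ> \<tau> \<circ> \<sigma>) \<circ> inv \<sigma> = \<tau>"
      by (simp add: fun_eq_iff Sym_inverses[OF \<sigma>])
    have "inv \<sigma> \<circ> (\<sigma> \<circ> t) = t"
      by (simp add: fun_eq_iff Sym_inverses[OF \<sigma>])
    then show "inv \<sigma> \<circ> \<tau> \<circ> \<sigma> \<in> col_stab n lam t"
      using col_stab_conjugate[OF Sym_inv[OF \<sigma>] \<tau>] by (simp add: Sym_inverses[OF \<sigma>])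
  qed
  finally show ?thesis .
qed

lemma specht_act_in_specht:
  fixes v :: "nat set list \<Rightarrow> 'f::field_char_0"
  assumes \<sigma>: "\<sigma> \<in> Sym n" and v: "v \<in> specht n lam"
  shows "specht_act n lam \<sigma> v \<in> specht n lam"
proof -
  have lin: "linear_on fscale fscale UNIV (specht_act n lam \<sigma> :: (_ \<Rightarrow> 'f) \<Rightarrow> _)"
    unfolding specht_act_def by (rule linear_on_lin_ext)
  have "fn.subspace {v :: _ \<Rightarrow> 'f. specht_act n lam \<sigma> v \<in> specht n lam}"
    unfolding fn.subspace_def
  proof (safe intro!: CollectI)
    have "specht_act n lam \<sigma> 0 = (0 :: nat set list \<Rightarrow> 'f)"
      by (auto simp: specht_act_apply[OF \<sigma>])
    then show "specht_act n lam \<sigma> (0 :: nat set list \<Rightarrow> 'f) \<in> specht n lam"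
      by (simp add: specht_def fn.span_zero)
  qed (use lin in \<open>auto simp: linear_on_def specht_def fn.span_add fn.span_scale\<close>)
  moreover have "{polytabloid n lam t | t. tableau n lam t} \<subseteq> {v. specht_act n lam \<sigma> v \<in> specht n lam}"
    using \<sigma> by (auto simp: specht_act_polytabloid specht_def intro!: fn.span_base tableau_comp)
  ultimately show ?thesis
    using v fn.span_minimal unfolding specht_def by blast
qed

text \<open>
  A tableau is a function on all pairs, with arbitrary values off the diagram; a polytabloid sees
  only the entries in the finitely many cells.
\<close>
lemma finite_polytabloids: "finite {polytabloid n lam t | t. tableau n lam t}"
proof -
  have cells: "finite (cells lam)"
    by (rule finite_subset[of _ "{..<length lam} \<times> {..<sum_list lam}"])
      (auto simp: cells_def dest: elem_le_sum_list)
  have "polytabloid n lam t = polytabloid n lam (restrict t (cells lam))" for t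
  proof -
    have "tabloid lam (restrict t (cells lam)) = tabloid lam t"
      by (auto simp: tabloid_def cells_def)
    moreover have "column lam (restrict t (cells lam)) = column lam t"
      by (auto simp: column_def fun_eq_iff)
    ultimately show ?thesis
      by (simp add: polytabloid_def col_stab_def)
  qed
  moreover have "restrict t (cells lam) \<in> (PiE (cells lam) (\<lambda>_. {1..n}))" if "tableau n lam t" for t
    using that by (auto simp: restrict_PiE_iff tableau_def dest: bij_betwE)
  ultimately have "{polytabloid n lam t | t. tableau n lam t}
      \<subseteq> polytabloid n lam ` (PiE (cells lam) (\<lambda>_. {1..n}))"
    by blast
  then show ?thesis
    by (rule finite_subset) (simp add: finite_PiE cells)
qed

lemma specht_supported: "v \<in> specht n lam \<Longrightarrow> T \<notin> tabloids n lam \<Longrightarrow> v T = 0"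
proof -
  assume "v \<in> specht n lam" "T \<notin> tabloids n lam"
  have "fn.subspace {v. \<forall>T. T \<notin> tabloids n lam \<longrightarrow> v T = 0}"
    by (auto simp: fn.subspace_def fscale_def)
  moreover have "{polytabloid n lam t | t. tableau n lam t} \<subseteq> {v. \<forall>T. T \<notin> tabloids n lam \<longrightarrow> v T = 0}"
    by (auto simp: polytabloid_def sum_fun_apply fscale_def basis_vec_def
        intro!: sum.neutral dest!: col_stab_Sym tabloid_in tabloids_map)
  ultimately show ?thesis
    using \<open>v \<in> specht n lam\<close> \<open>T \<notin> tabloids n lam\<close> fn.span_minimal unfolding specht_def by blast
qed

lemma subspace_specht: "fn.subspace (specht n lam)"
  unfolding specht_def by (rule fn.subspace_span)

lemma linear_on_specht_act: "linear_on fscale fscale V (specht_act n lam \<sigma>)"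
  unfolding specht_act_def by (rule linear_on_lin_ext)

lemma linear_on_tensor_act: "linear_on fscale fscale V (tensor_act n k \<sigma>)"
  unfolding tensor_act_def by (rule linear_on_lin_ext)

lemma specht_act_comp:
  assumes "\<sigma> \<in> Sym n" "\<tau> \<in> Sym n"
  shows "specht_act n lam (\<sigma> \<circ> \<tau>) f = specht_act n lam \<sigma> (specht_act n lam \<tau> f)"
proof -
  have "inv (\<sigma> \<circ> \<tau>) = inv \<tau> \<circ> inv \<sigma>"
    using assms by (simp add: Sym_def o_inv_distrib permutes_bij)
  moreover have "map (image (f \<circ> g)) T = map (image f) (map (image g) T)" for f g :: "nat \<Rightarrow> nat" and T
    by (induction T) (auto simp: image_comp)
  ultimately show ?thesis
    using tabloids_map[OF Sym_inv[OF assms(1)]]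
    by (intro ext) (simp add: specht_act_apply[OF assms(1)] specht_act_apply[OF assms(2)]
        specht_act_apply[OF Sym_comp[OF assms]] del: map_map)
qed

lemma id_Sym: "id \<in> Sym n"
  by (simp add: Sym_def permutes_id)

lemma specht_act_id: "v \<in> specht n lam \<Longrightarrow> specht_act n lam id v = v"
  by (auto simp: specht_act_apply id_Sym specht_supported)

lemma subspace_tensor_power: "fn.subspace (tensor_power n k)"
  by (auto simp: fn.subspace_def tensor_power_def fscale_def)

section \<open>The trace on equivariant maps\<close>

lemma hom_specht_iff: "\<phi> \<in> hom_specht n k lam \<longleftrightarrow>
    linear_on fscale fscale (specht n lam) \<phi> \<and> (\<forall>v\<in>specht n lam. \<phi> v \<in> tensor_power n k) \<and>
    (\<forall>\<sigma>\<in>Sym n. \<forall>v\<in>specht n lam. \<phi> (specht_act n lam \<sigma> v) = tensor_act n k \<sigma> (\<phi> v)) \<and>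
    (\<forall>v. v \<notin> specht n lam \<longrightarrow> \<phi> v = 0)"
  by (auto simp: hom_specht_def linear_on_def)

lemma subspace_hom_specht:
  "mp.subspace (hom_specht n k lam :: ((nat set list \<Rightarrow> 'f::field_char_0) \<Rightarrow> nat list \<Rightarrow> 'f) set)"
proof -
  have "tensor_act n k \<sigma> (v + w) = tensor_act n k \<sigma> v + tensor_act n k \<sigma> w"
    "tensor_act n k \<sigma> (fscale c v) = fscale c (tensor_act n k \<sigma> v)" for \<sigma> c and v w :: "_ \<Rightarrow> 'f"
    using linear_on_tensor_act[of UNIV n k \<sigma>] by (auto simp: linear_on_def)
  moreover have "tensor_act n k \<sigma> (0 :: _ \<Rightarrow> 'f) = 0" for \<sigma>
    by (simp add: fun_eq_iff tensor_act_def lin_ext_apply)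
  ultimately show ?thesis
    unfolding mp.subspace_def
    by (auto simp: hom_specht_iff linear_on_def mapscale_def fn.scale_right_distrib
        fn.scale_left_commute fn.subspace_0[OF subspace_tensor_power]
        fn.subspace_add[OF subspace_tensor_power] fn.subspace_scale[OF subspace_tensor_power])
qed

lemma sum_Sym_left_translate:
  assumes "\<tau> \<in> Sym n"
  shows "(\<Sum>\<sigma>\<in>Sym n. h (\<tau> \<circ> \<sigma>)) = (\<Sum>\<sigma>\<in>Sym n. h \<sigma>)"
  by (rule sum.reindex_bij_witness[where i = "\<lambda>\<sigma>. inv \<tau> \<circ> \<sigma>" and j = "\<lambda>\<sigma>. \<tau> \<circ> \<sigma>"])
    (auto simp: Sym_inverses[OF assms] fun_eq_iff intro: Sym_comp Sym_inv assms)

lemma specht_basis: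
  obtains B :: "(nat set list \<Rightarrow> 'f::field_char_0) set" where
    "finite B" "\<not> fn.dependent B" "fn.span B = specht n lam"
    "\<And>\<sigma>. chi n lam \<sigma> = (\<Sum>b\<in>B. fn.representation B (specht_act n lam \<sigma> b) b)"
proof -
  obtain B :: "(nat set list \<Rightarrow> 'f) set" where B: "finite B" "\<not> fn.dependent B" "fn.span B = specht n lam"
    "\<And>T. trace_on fscale (specht n lam) T = (\<Sum>b\<in>B. fn.representation B (T b) b)"
    using fn.trace_on_basis[OF finite_polytabloids specht_def[symmetric]] by blast
  show ?thesis
    by (rule that[of B]) (simp_all add: B chi_def)
qed

lemma basis_vec_tensor_power: "r \<in> tuples n k \<Longrightarrow> basis_vec r \<in> tensor_power n k"
  by (auto simp: tensor_power_def basis_vec_def)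

text \<open>
  With a basis \<open>B\<close> of the Specht module and the standard basis of the tensor power, the elementary
  maps \<open>v \<mapsto> b\<^sup>*(v) e\<^sub>r\<close> form a basis of all linear maps, dual to the matrix entries \<open>\<phi> \<mapsto> \<phi>(b)\<^sub>r\<close>.
  Averaging them over the group yields equivariant maps \<open>E r b\<close>.  An equivariant map is its own
  average, so the \<open>E r b\<close> with the same matrix entries are a frame of the equivariant maps, and the
  trace in this frame splits for each \<open>\<sigma>\<close> into a trace on each of the two modules.
\<close>
lemma trace_on_hom_specht:
  fixes A :: "(nat list \<Rightarrow> 'f::field_char_0) \<Rightarrow> nat list \<Rightarrow> 'f"
  assumes A: "linear_on fscale fscale (tensor_power n k) A"
    "\<And>w. w \<in> tensor_power n k \<Longrightarrow> A w \<in> tensor_power n k"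
    "\<And>\<sigma> w. \<sigma> \<in> Sym n \<Longrightarrow> w \<in> tensor_power n k \<Longrightarrow> A (tensor_act n k \<sigma> w) = tensor_act n k \<sigma> (A w)"
  shows "trace_on mapscale (hom_specht n k lam) (\<lambda>\<phi>. A \<circ> \<phi>) =
    (\<Sum>\<sigma>\<in>Sym n. (\<Sum>r\<in>tuples n k. A (basis_vec (map \<sigma> r)) r) * chi n lam (inv \<sigma>)) / fact n"
proof -
  let ?V = "specht n lam :: (nat set list \<Rightarrow> 'f) set" and ?W = "tensor_power n k :: (nat list \<Rightarrow> 'f) set"
  let ?H = "hom_specht n k lam :: ((nat set list \<Rightarrow> 'f) \<Rightarrow> nat list \<Rightarrow> 'f) set"
  obtain B where B: "finite B" "\<not> fn.dependent B" "fn.span B = ?V"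
    and chi: "\<And>\<sigma>. chi n lam \<sigma> = (\<Sum>b\<in>B. fn.representation B (specht_act n lam \<sigma> b) b)"
    using specht_basis by blast
  have BV: "b \<in> ?V" if "b \<in> B" for b
    using B(3) that fn.span_base by blast
  define co where "co b \<sigma> v = fn.representation B (specht_act n lam (inv \<sigma>) v) b" for b \<sigma> v
  define S where "S r b v = (\<Sum>\<sigma>\<in>Sym n. fscale (co b \<sigma> v) (basis_vec (map \<sigma> r) :: nat list \<Rightarrow> 'f))"
    for r b v
  define E where "E r b = (\<lambda>v. if v \<in> ?V then fscale (1 / fact n) (S r b v) else 0)" for r b
  have lin_V: "specht_act n lam \<sigma> (v + w) = specht_act n lam \<sigma> v + specht_act n lam \<sigma> w"
    "specht_act n lam \<sigma> (fscale c v) = fscale c (specht_act n lam \<sigma> v)" for \<sigma> c and v w :: "_ \<Rightarrow> 'f"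
    using linear_on_specht_act[of UNIV n lam \<sigma>] by (auto simp: linear_on_def)
  have co_add: "co b \<sigma> (v + w) = co b \<sigma> v + co b \<sigma> w"
    if "\<sigma> \<in> Sym n" "v \<in> ?V" "w \<in> ?V" for b \<sigma> v w
    using that B by (simp add: co_def lin_V fn.representation_add specht_act_in_specht Sym_inv)
  have co_scale: "co b \<sigma> (fscale c v) = c * co b \<sigma> v" if "\<sigma> \<in> Sym n" "v \<in> ?V" for b \<sigma> c v
    using that B by (simp add: co_def lin_V fn.representation_scale specht_act_in_specht Sym_inv)
  have co_comp: "co b (\<tau> \<circ> \<sigma>) (specht_act n lam \<tau> v) = co b \<sigma> v"
    if "\<sigma> \<in> Sym n" "\<tau> \<in> Sym n" for b \<sigma> \<tau> v
  proof -
    have "inv (\<tau> \<circ> \<sigma>) \<circ> \<tau> = inv \<sigma>"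
      using that Sym_inverses[OF that(2)]
      by (auto simp: Sym_def o_inv_distrib permutes_bij fun_eq_iff)
    then show ?thesis
      using that by (simp add: co_def specht_act_comp[symmetric] Sym_comp Sym_inv)
  qed
  have SW: "S r b v \<in> ?W" if "r \<in> tuples n k" for r b v
    unfolding S_def using that
    by (intro fn.subspace_sum[OF subspace_tensor_power] fn.subspace_scale[OF subspace_tensor_power]
        basis_vec_tensor_power tuples_map)
  have SE: "S r b (specht_act n lam \<tau> v) = tensor_act n k \<tau> (S r b v)"
    if "r \<in> tuples n k" "\<tau> \<in> Sym n" for r b \<tau> v
  proof -
    have "tensor_act n k \<tau> (S r b v)
        = (\<Sum>\<sigma>\<in>Sym n. fscale (co b \<sigma> v) (tensor_act n k \<tau> (basis_vec (map \<sigma> r))))"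
      unfolding S_def
      by (rule fn.linear_on_sum[where V = UNIV]) (auto simp: linear_on_tensor_act)
    also have "\<dots> = (\<Sum>\<sigma>\<in>Sym n. fscale (co b (\<tau> \<circ> \<sigma>) (specht_act n lam \<tau> v)) (basis_vec (map (\<tau> \<circ> \<sigma>) r)))"
      using that
      by (intro sum.cong) (auto simp: co_comp tensor_act_def lin_ext_basis_vec finite_tuples tuples_map)
    also have "\<dots> = S r b (specht_act n lam \<tau> v)"
      unfolding S_def using that(2) by (rule sum_Sym_left_translate)
    finally show ?thesis ..
  qed
  have EH: "E r b \<in> ?H" if r: "r \<in> tuples n k" for r b
    unfolding hom_specht_iff linear_on_def
  proof (intro conjI ballI allI impI)
    fix v w assume "v \<in> ?V" "w \<in> ?V"
    then show "E r b (v + w) = E r b v + E r b w"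
      by (simp add: E_def S_def fn.subspace_add[OF subspace_specht] co_add fn.scale_left_distrib
          fn.scale_right_distrib sum.distrib cong: sum.cong)
  next
    fix c v assume "v \<in> ?V"
    then show "E r b (fscale c v) = fscale c (E r b v)"
      by (simp add: E_def S_def fn.subspace_scale[OF subspace_specht] co_scale fn.scale_sum_right
          mult.left_commute mult.commute cong: sum.cong)
  next
    fix v assume "v \<in> ?V"
    then show "E r b v \<in> ?W"
      using SW[OF r] by (simp add: E_def fn.subspace_scale[OF subspace_tensor_power])
  next
    fix \<tau> v assume "\<tau> \<in> Sym n" "v \<in> ?V"
    moreover have "tensor_act n k \<tau> (fscale c w) = fscale c (tensor_act n k \<tau> w)" for c and w :: "_ \<Rightarrow> 'f"
      using linear_on_tensor_act[of UNIV n k \<tau>] by (auto simp: linear_on_def)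
    ultimately show "E r b (specht_act n lam \<tau> v) = tensor_act n k \<tau> (E r b v)"
      using SE[OF r] by (simp add: E_def specht_act_in_specht)
  qed (simp add: E_def)
  let ?I = "tuples n k \<times> B"
  have frame: "\<phi> = (\<Sum>(r, b)\<in>?I. mapscale (\<phi> b r) (E r b))" if \<phi>: "\<phi> \<in> ?H" for \<phi>
  proof
    fix v
    show "\<phi> v = (\<Sum>(r, b)\<in>?I. mapscale (\<phi> b r) (E r b)) v"
    proof (cases "v \<in> ?V")
      case v: True
      \<comment> \<open>Equivariance at a single \<open>\<sigma>\<close> already expresses \<open>\<phi> v\<close>; these expressions are averaged below.\<close>
      have avg: "\<phi> v = (\<Sum>b\<in>B. \<Sum>r\<in>tuples n k. fscale (co b \<sigma> v * \<phi> b r) (basis_vec (map \<sigma> r)))"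
        if \<sigma>: "\<sigma> \<in> Sym n" for \<sigma>
      proof -
        let ?w = "specht_act n lam (inv \<sigma>) v"
        have w: "?w \<in> ?V"
          using v \<sigma> by (simp add: specht_act_in_specht Sym_inv)
        have "\<phi> ?w = \<phi> (\<Sum>b\<in>B. fscale (co b \<sigma> v) b)"
          using w B by (simp add: co_def fn.sum_representation_eq)
        also have "\<dots> = (\<Sum>b\<in>B. fscale (co b \<sigma> v) (\<phi> b))"
          using \<phi> BV by (intro fn.linear_on_sum[OF subspace_specht]) (auto simp: hom_specht_iff)
        finally have 1: "\<phi> ?w = (\<Sum>b\<in>B. fscale (co b \<sigma> v) (\<phi> b))" .
        have "v = specht_act n lam \<sigma> ?w"
          using v \<sigma> by (simp add: specht_act_comp[symmetric] Sym_inv Sym_inverses specht_act_id)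
        then have "\<phi> v = tensor_act n k \<sigma> (\<phi> ?w)"
          using \<phi> \<sigma> w by (metis hom_specht_iff)
        also have "\<dots> = (\<Sum>b\<in>B. fscale (co b \<sigma> v) (tensor_act n k \<sigma> (\<phi> b)))"
          unfolding 1 by (rule fn.linear_on_sum[where V = UNIV]) (auto simp: linear_on_tensor_act)
        finally show ?thesis
          by (simp add: tensor_act_def lin_ext_def fn.scale_sum_right)
      qed
      have "of_nat (card (Sym n)) * \<phi> v s = fact n * (\<Sum>(r, b)\<in>?I. mapscale (\<phi> b r) (E r b)) v s" for s
      proof -
        have "of_nat (card (Sym n)) * \<phi> v s = (\<Sum>\<sigma>\<in>Sym n. \<phi> v s)"
          by simp
        also have "\<dots> = (\<Sum>\<sigma>\<in>Sym n. \<Sum>b\<in>B. \<Sum>r\<in>tuples n k.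
            co b \<sigma> v * \<phi> b r * (basis_vec (map \<sigma> r) s))"
          by (intro sum.cong refl, subst avg) (simp_all add: sum_fun_apply fscale_def)
        also have "\<dots> = (\<Sum>b\<in>B. \<Sum>r\<in>tuples n k. \<Sum>\<sigma>\<in>Sym n.
            co b \<sigma> v * \<phi> b r * (basis_vec (map \<sigma> r) s))"
          by (subst sum.swap, intro sum.cong refl, subst sum.swap, rule refl)
        also have "\<dots> = (\<Sum>b\<in>B. \<Sum>r\<in>tuples n k. fact n * (\<phi> b r * E r b v s))"
          using v by (simp add: E_def S_def fscale_def sum_fun_apply sum_distrib_left mult_ac)
        also have "\<dots> = (\<Sum>r\<in>tuples n k. \<Sum>b\<in>B. fact n * (\<phi> b r * E r b v s))"
          by (rule sum.swap)
        also have "\<dots> = fact n * (\<Sum>(r, b)\<in>?I. mapscale (\<phi> b r) (E r b)) v s"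
          by (simp add: sum_fun_apply mapscale_def fscale_def sum.cartesian_product sum_distrib_left
              case_prod_unfold)
        finally show ?thesis .
      qed
      then show ?thesis
        by (auto simp: card_Sym)
    next
      case False
      then show ?thesis
        using \<phi> by (auto simp: hom_specht_iff E_def sum_fun_apply mapscale_def fscale_def
            intro!: ext sum.neutral)
    qed
  qed
  \<comment> \<open>Needed off the Specht module, where the equivariant maps vanish by convention.\<close>
  have "A 0 = 0"
    using A(1) fn.subspace_0[OF subspace_tensor_power[of n k]] unfolding linear_on_def
    by (metis add_cancel_right_left)
  have AH: "A \<circ> \<phi> \<in> ?H" if "\<phi> \<in> ?H" for \<phi>
    using that A \<open>A 0 = 0\<close> by (auto simp: hom_specht_iff linear_on_def)
  have AE: "A (E r b b) r = (\<Sum>\<sigma>\<in>Sym n. co b \<sigma> b * A (basis_vec (map \<sigma> r)) r) / fact n"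
    if "r \<in> tuples n k" "b \<in> B" for r b
  proof -
    have "A (E r b b) = fscale (1 / fact n) (A (S r b b))"
      using A(1) SW[OF that(1)] BV[OF that(2)] by (simp add: E_def linear_on_def)
    moreover have "A (S r b b) = (\<Sum>\<sigma>\<in>Sym n. fscale (co b \<sigma> b) (A (basis_vec (map \<sigma> r))))"
      unfolding S_def using that(1)
      by (intro fn.linear_on_sum[OF subspace_tensor_power A(1)]) (auto intro: basis_vec_tensor_power tuples_map)
    ultimately show ?thesis
      by (simp add: sum_fun_apply fscale_def)
  qed
  have "trace_on mapscale ?H (\<lambda>\<phi>. A \<circ> \<phi>) = (\<Sum>i\<in>?I. (\<lambda>(r, b). \<lambda>\<phi>. \<phi> b r) i ((\<lambda>\<phi>. A \<circ> \<phi>) ((\<lambda>(r, b). E r b) i)))"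
  proof (rule mp.trace_on_frame)
    have "\<phi> v \<in> ?W" if "\<phi> \<in> ?H" for \<phi> v
      using that fn.subspace_0[OF subspace_tensor_power[of n k]]
      by (cases "v \<in> ?V") (auto simp: hom_specht_iff)
    then show "linear_on mapscale mapscale ?H ((\<circ>) A)"
      using A(1) by (simp add: linear_on_def mapscale_def o_def plus_fun_def)
  next
    fix \<phi> assume "\<phi> \<in> ?H"
    from frame[OF this]
    show "\<phi> = (\<Sum>i\<in>?I. mapscale ((\<lambda>(r, b). \<lambda>\<phi>. \<phi> b r) i \<phi>) ((\<lambda>(r, b). E r b) i))"
      by (simp add: case_prod_unfold)
  qed (use B(1) in \<open>auto simp: finite_tuples subspace_hom_specht EH AH[unfolded o_def] linear_on_def mapscale_def fscale_def\<close>)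
  also have "\<dots> = (\<Sum>r\<in>tuples n k. \<Sum>b\<in>B. (\<Sum>\<sigma>\<in>Sym n. co b \<sigma> b * A (basis_vec (map \<sigma> r)) r) / fact n)"
    by (auto simp: sum.cartesian_product AE intro!: sum.cong)
  also have "\<dots> = (\<Sum>r\<in>tuples n k. \<Sum>\<sigma>\<in>Sym n. \<Sum>b\<in>B. co b \<sigma> b * A (basis_vec (map \<sigma> r)) r) / fact n"
    by (simp only: sum_divide_distrib, intro sum.cong refl, rule sum.swap)
  also have "\<dots> = (\<Sum>\<sigma>\<in>Sym n. \<Sum>r\<in>tuples n k. \<Sum>b\<in>B. co b \<sigma> b * A (basis_vec (map \<sigma> r)) r) / fact n"
    by (subst sum.swap) (rule refl)
  also have "\<dots> = (\<Sum>\<sigma>\<in>Sym n. (\<Sum>r\<in>tuples n k. A (basis_vec (map \<sigma> r)) r) * chi n lam (inv \<sigma>)) / fact n"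
    by (simp add: chi co_def sum_product mult.commute)
  finally show ?thesis .
qed

text \<open>
  The translates \<open>\<rho>\<^sup>-\<^sup>1 b\<close> of a basis with the coordinates of \<open>\<rho> v\<close> are again a frame; the trace of \<open>\<sigma>\<close>
  computed in it is the trace of \<open>\<rho> \<sigma> \<rho>\<^sup>-\<^sup>1\<close> computed in the basis.
\<close>
lemma chi_conjugate:
  assumes \<rho>: "\<rho> \<in> Sym n" and \<sigma>: "\<sigma> \<in> Sym n"
  shows "(chi n lam (\<rho> \<circ> \<sigma> \<circ> inv \<rho>) :: 'f::field_char_0) = chi n lam \<sigma>"
proof -
  let ?V = "specht n lam :: (nat set list \<Rightarrow> 'f) set"
  obtain B where B: "finite B" "\<not> fn.dependent B" "fn.span B = ?V"
    and chi: "\<And>\<sigma>. chi n lam \<sigma> = (\<Sum>b\<in>B. fn.representation B (specht_act n lam \<sigma> b) b)"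
    using specht_basis by blast
  have BV: "b \<in> ?V" if "b \<in> B" for b
    using B(3) that fn.span_base by blast
  let ?f = "\<lambda>b v. fn.representation B (specht_act n lam \<rho> v) b"
  let ?u = "specht_act n lam (inv \<rho>)"
  have lin_V: "specht_act n lam \<sigma> (v + w) = specht_act n lam \<sigma> v + specht_act n lam \<sigma> w"
    "specht_act n lam \<sigma> (fscale c v) = fscale c (specht_act n lam \<sigma> v)" for \<sigma> c and v w :: "_ \<Rightarrow> 'f"
    using linear_on_specht_act[of UNIV n lam \<sigma>] by (auto simp: linear_on_def)
  have "chi n lam \<sigma> = (\<Sum>b\<in>B. ?f b (specht_act n lam \<sigma> (?u b)))"
    unfolding chi_def
  proof (rule fn.trace_on_frame)
    fix v assume v: "v \<in> ?V"
    have "v = ?u (specht_act n lam \<rho> v)"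
      using v \<rho> by (simp add: specht_act_comp[symmetric] Sym_inv Sym_inverses specht_act_id)
    also have "\<dots> = ?u (\<Sum>b\<in>B. fscale (?f b v) b)"
      using B v \<rho> by (simp add: fn.sum_representation_eq specht_act_in_specht)
    also have "\<dots> = (\<Sum>b\<in>B. fscale (?f b v) (?u b))"
      by (rule fn.linear_on_sum[where V = UNIV]) (auto simp: linear_on_specht_act)
    finally show "v = (\<Sum>b\<in>B. fscale (?f b v) (?u b))" .
  next
    fix b
    show "linear_on fscale (*) ?V (?f b)"
      using B \<rho> by (simp add: linear_on_def lin_V fn.representation_add fn.representation_scale specht_act_in_specht)
  (* Q *)
qed (simp_all add: B subspace_specht BV specht_act_in_specht Sym_inv \<rho> \<sigma> linear_on_specht_act)
  also have "\<dots> = chi n lam (\<rho> \<circ> \<sigma> \<circ> inv \<rho>)"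
    unfolding chi specht_act_comp[OF Sym_comp[OF \<rho> \<sigma>] Sym_inv[OF \<rho>]] specht_act_comp[OF \<rho> \<sigma>] ..
  finally show ?thesis ..
qed

section \<open>The trace of a diagram as a number of words\<close>

lemma finite_partitions: "finite {\<pi>. partition_on {1..2 * k :: nat} \<pi>}"
  by (rule finitely_many_partition_on) simp

lemma Phi_dgm_apply:
  "Phi_dgm n k \<pi> f s = (if s \<in> tuples n k
     then \<Sum>r\<in>tuples n k. if constant_on_blocks \<pi> (r @ s) then f r else 0 else 0)"
proof -
  have fin: "finite {s. s \<in> tuples n k \<and> constant_on_blocks \<pi> (r @ s)}" for r
    using finite_tuples by (rule finite_subset[rotated]) auto
  have "(\<Sum>s' | s' \<in> tuples n k \<and> constant_on_blocks \<pi> (r @ s'). basis_vec s') s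
      = (if s \<in> tuples n k \<and> constant_on_blocks \<pi> (r @ s) then 1 else (0 :: 'a))" for r
  proof -
    have "(\<Sum>s' | s' \<in> tuples n k \<and> constant_on_blocks \<pi> (r @ s'). basis_vec s') s
      = (\<Sum>s' | s' \<in> tuples n k \<and> constant_on_blocks \<pi> (r @ s'). if s = s' then 1 else (0::'a))"
      by (simp add: sum_fun_apply basis_vec_def)
    then show ?thesis
      using fin[of r] by (simp only: sum.delta' mem_Collect_eq)
  qed
  then show ?thesis
    unfolding Phi_dgm_def lin_ext_apply by (auto intro!: sum.cong)
qed

lemma Phi_of_dgm:
  assumes "partition_on {1..2 * k} \<pi>"
  shows "Phi n k (dgm \<pi>) = (Phi_dgm n k \<pi> :: (_ \<Rightarrow> 'f::field_char_0) \<Rightarrow> _)"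
proof (intro ext)
  fix f :: "nat list \<Rightarrow> 'f" and s
  have "Phi n k (dgm \<pi>) f s
      = (\<Sum>\<rho> | partition_on {1..2 * k} \<rho>. if \<rho> = \<pi> then Phi_dgm n k \<pi> f s else 0)"
    unfolding Phi_def sum_fun_apply dgm_def basis_vec_def fscale_def by (intro sum.cong) auto
  then show "Phi n k (dgm \<pi>) f s = Phi_dgm n k \<pi> f s"
    using finite_partitions assms by (simp only: sum.delta mem_Collect_eq if_True)
qed

lemma constant_on_blocks_map:
  assumes "inj \<sigma>" "\<Union>\<pi> \<subseteq> {1..length w}"
  shows "constant_on_blocks \<pi> (map \<sigma> w) \<longleftrightarrow> constant_on_blocks \<pi> w"
proof -
  have "map \<sigma> w ! (a - 1) = map \<sigma> w ! (b - 1) \<longleftrightarrow> w ! (a - 1) = w ! (b - 1)"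
    if "B \<in> \<pi>" "a \<in> B" "b \<in> B" for a b B
  proof -
    have "a \<in> {1..length w}" "b \<in> {1..length w}"
      using assms(2) that by blast+
    then have "a - 1 < length w" "b - 1 < length w"
      by auto
    then show ?thesis
      using assms(1) by (simp add: inj_eq)
  qed
  then show ?thesis
    unfolding constant_on_blocks_def by blast
qed

text \<open>
  Being constant on blocks is a matter of equalities between letters, which an injective renaming
  of the letters does not change.
\<close>
lemma Phi_dgm_tensor_act:
  assumes \<pi>: "partition_on {1..2 * k} \<pi>" and \<sigma>: "\<sigma> \<in> Sym n"
  shows "Phi_dgm n k \<pi> (tensor_act n k \<sigma> f) = tensor_act n k \<sigma> (Phi_dgm n k \<pi> f)"
proof
  fix s
  have cob: "constant_on_blocks \<pi> (r @ s) \<longleftrightarrow> constant_on_blocks \<pi> (map (inv \<sigma>) r @ map (inv \<sigma>) s)"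
    if "r \<in> tuples n k" "s \<in> tuples n k" for r
    using constant_on_blocks_map[of "inv \<sigma>" \<pi> "r @ s"] that \<pi> Sym_inv[OF \<sigma>]
    by (auto simp: Sym_def permutes_inj tuples_def partition_on_def mult_2)
  have "(\<Sum>r\<in>tuples n k. if constant_on_blocks \<pi> (r @ s) then f (map (inv \<sigma>) r) else 0)
      = (\<Sum>r\<in>tuples n k. if constant_on_blocks \<pi> (r @ map (inv \<sigma>) s) then f r else 0)"
    if "s \<in> tuples n k"
    using that cob
    by (intro sum.reindex_bij_witness[where i = "map \<sigma>" and j = "map (inv \<sigma>)"])
      (auto simp: comp_def Sym_inverses[OF \<sigma>] tuples_map \<sigma> Sym_inv)
  then show "Phi_dgm n k \<pi> (tensor_act n k \<sigma> f) s = tensor_act n k \<sigma> (Phi_dgm n k \<pi> f) s"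
    by (simp add: tensor_act_apply[OF \<sigma>] Phi_dgm_apply tuples_map Sym_inv \<sigma> cong: sum.cong if_cong)
qed

text \<open>
  The words that contribute to the trace of the diagram composed with \<open>\<sigma>\<close>; the diagram carries its
  number of columns, as in \<^const>\<open>juxtapose\<close>.
\<close>
definition twisted_fixed_words :: "nat \<Rightarrow> (nat \<Rightarrow> nat) \<Rightarrow> nat \<times> nat set set \<Rightarrow> nat list set" where
  "twisted_fixed_words n \<sigma> d =
     {r \<in> tuples n (fst d). constant_on_blocks (snd d) (map \<sigma> r @ r)}"

lemma xi_dgm:
  assumes \<pi>: "partition_on {1..2 * k} \<pi>"
  shows "(xi n k lam (dgm \<pi>) :: 'f::field_char_0) =
    (\<Sum>\<sigma>\<in>Sym n. of_nat (card (twisted_fixed_words n \<sigma> (k, \<pi>))) * chi n lam (inv \<sigma>)) / fact n"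
proof -
  have "(xi n k lam (dgm \<pi>) :: 'f) =
    (\<Sum>\<sigma>\<in>Sym n. (\<Sum>r\<in>tuples n k. Phi_dgm n k \<pi> (basis_vec (map \<sigma> r)) r) * chi n lam (inv \<sigma>)) / fact n"
    unfolding xi_def Phi_of_dgm[OF \<pi>]
  proof (rule trace_on_hom_specht)
    show "linear_on fscale fscale (tensor_power n k) (Phi_dgm n k \<pi> :: (_ \<Rightarrow> 'f) \<Rightarrow> _)"
      unfolding Phi_dgm_def by (rule linear_on_lin_ext)
  qed (auto simp: Phi_dgm_tensor_act[OF \<pi>] tensor_power_def Phi_dgm_apply)
  also have "(\<Sum>r\<in>tuples n k. Phi_dgm n k \<pi> (basis_vec (map \<sigma> r)) r) =
      (of_nat (card (twisted_fixed_words n \<sigma> (k, \<pi>))) :: 'f)" if \<sigma>: "\<sigma> \<in> Sym n" for \<sigma>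
  proof -
    have "Phi_dgm n k \<pi> (basis_vec (map \<sigma> r)) r =
        (if constant_on_blocks \<pi> (map \<sigma> r @ r) then 1 else (0 :: 'f))" if "r \<in> tuples n k" for r
    proof -
      have "Phi_dgm n k \<pi> (basis_vec (map \<sigma> r)) r =
        (\<Sum>r'\<in>tuples n k. if r' = map \<sigma> r then (if constant_on_blocks \<pi> (map \<sigma> r @ r) then 1 else 0) else (0::'f))"
        unfolding Phi_dgm_apply if_P[OF that] basis_vec_def by (intro sum.cong) auto
      then show ?thesis
        using that \<sigma> by (simp add: finite_tuples tuples_map)
    qed
    then have "(\<Sum>r\<in>tuples n k. Phi_dgm n k \<pi> (basis_vec (map \<sigma> r)) r) =
        (\<Sum>r\<in>tuples n k. if constant_on_blocks \<pi> (map \<sigma> r @ r) then 1 else (0 :: 'f))"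
      by (intro sum.cong) auto
    then show ?thesis
      by (simp add: twisted_fixed_words_def sum.inter_filter[symmetric] finite_tuples)
  qed
  ultimately show ?thesis
    by (simp cong: sum.cong)
qed

lemma partition_on_Un:
  assumes "partition_on A P" "partition_on B Q" "A \<inter> B = {}"
  shows "partition_on (A \<union> B) (P \<union> Q)"
  using assms unfolding partition_on_def by (auto intro!: disjoint_union)

lemma partition_on_image:
  assumes "partition_on A P" "inj_on f A"
  shows "partition_on (f ` A) (image f ` P)"
proof -
  have "{} \<notin> image f ` P"
    using assms(1) by (auto simp: partition_on_def)
  then show ?thesis
    using partition_on_inj_image[OF assms] by simp
qed

lemma partition_on_juxtapose:
  assumes "partition_on {1..2 * a} \<pi>" "partition_on {1..2 * b} \<rho>"
  shows "partition_on {1..2 * (a + b)} (snd (juxtapose (a, \<pi>) (b, \<rho>)))"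
proof -
  let ?f = "\<lambda>i. if i \<le> a then i else i + b" and ?g = "\<lambda>i. if i \<le> b then i + a else i + 2 * a"
  have f: "?f ` {1..2 * a} = {1..a} \<union> {a + b + 1..2 * a + b}"
  proof
    show "{1..a} \<union> {a + b + 1..2 * a + b} \<subseteq> ?f ` {1..2 * a}"
    proof
      fix i assume "i \<in> {1..a} \<union> {a + b + 1..2 * a + b}"
      then show "i \<in> ?f ` {1..2 * a}"
        by (intro image_eqI[of _ _ "if i \<le> a then i else i - b"]) auto
    qed
  qed auto
  have g: "?g ` {1..2 * b} = {a + 1..a + b} \<union> {2 * a + b + 1..2 * (a + b)}"
  proof
    show "{a + 1..a + b} \<union> {2 * a + b + 1..2 * (a + b)} \<subseteq> ?g ` {1..2 * b}"
    proof
      fix i assume "i \<in> {a + 1..a + b} \<union> {2 * a + b + 1..2 * (a + b)}"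
      then show "i \<in> ?g ` {1..2 * b}"
        by (intro image_eqI[of _ _ "if i \<le> a + b then i - a else i - 2 * a"]) auto
    qed
  qed auto
  have "partition_on (?f ` {1..2 * a} \<union> ?g ` {1..2 * b}) (image ?f ` \<pi> \<union> image ?g ` \<rho>)"
  proof (intro partition_on_Un partition_on_image assms)
    show "?f ` {1..2 * a} \<inter> ?g ` {1..2 * b} = {}"
      unfolding f g by auto
  qed (auto simp: inj_on_def split: if_splits)
  moreover have "?f ` {1..2 * a} \<union> ?g ` {1..2 * b} = {1..2 * (a + b)}"
    unfolding f g by auto
  ultimately show ?thesis
    by simp
qed

text \<open>
  The relabelling of the vertices in a juxtaposition is exactly the relabelling of the positions
  when the bottom words and the top words are concatenated separately.
\<close>
lemma constant_on_blocks_juxtapose: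
  assumes "\<Union>\<pi> \<subseteq> {1..2 * a}" "\<Union>\<rho> \<subseteq> {1..2 * b}"
    and len: "length p = a" "length q = a" "length p' = b" "length q' = b"
  shows "constant_on_blocks (snd (juxtapose (a, \<pi>) (b, \<rho>))) ((p @ p') @ (q @ q')) \<longleftrightarrow>
    constant_on_blocks \<pi> (p @ q) \<and> constant_on_blocks \<rho> (p' @ q')"
proof -
  let ?w = "(p @ p') @ (q @ q')"
  let ?f = "\<lambda>i. if i \<le> a then i else i + b" and ?g = "\<lambda>i. if i \<le> b then i + a else i + 2 * a"
  have f: "?w ! (?f i - 1) = (p @ q) ! (i - 1)" if "i \<in> {1..2 * a}" for i
    using that len by (auto simp: nth_append)
  have g: "?w ! (?g i - 1) = (p' @ q') ! (i - 1)" if "i \<in> {1..2 * b}" for i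
    using that len by (auto simp: nth_append)
  have img: "constant_on_blocks (image h ` P) ?w \<longleftrightarrow> constant_on_blocks P u"
    if "\<Union>P \<subseteq> X" "\<And>i. i \<in> X \<Longrightarrow> ?w ! (h i - 1) = u ! (i - 1)" for h P X u
  proof -
    have "?w ! (h i - 1) = u ! (i - 1)" if "B \<in> P" "i \<in> B" for i B
      using that \<open>\<Union>P \<subseteq> X\<close> \<open>\<And>i. i \<in> X \<Longrightarrow> ?w ! (h i - 1) = u ! (i - 1)\<close> by blast
    then show ?thesis
      unfolding constant_on_blocks_def by simp
  qed
  have "constant_on_blocks (P \<union> Q) ?w \<longleftrightarrow> constant_on_blocks P ?w \<and> constant_on_blocks Q ?w" for P Q
    unfolding constant_on_blocks_def by blast
  then show ?thesis
    using img[OF assms(1) f] img[OF assms(2) g] by simp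
qed

lemma tuples_append: "bij_betw (\<lambda>(u, v). u @ v) (tuples n a \<times> tuples n b) (tuples n (a + b))"
  by (rule bij_betw_byWitness[where f' = "\<lambda>w. (take a w, drop a w)"])
    (auto simp: tuples_def subset_eq dest: in_set_takeD in_set_dropD)

lemma card_twisted_fixed_words_juxtapose:
  assumes "partition_on {1..2 * a} \<pi>" "partition_on {1..2 * b} \<rho>"
  shows "card (twisted_fixed_words n \<sigma> (juxtapose (a, \<pi>) (b, \<rho>))) =
    card (twisted_fixed_words n \<sigma> (a, \<pi>)) * card (twisted_fixed_words n \<sigma> (b, \<rho>))"
proof -
  let ?J = "snd (juxtapose (a, \<pi>) (b, \<rho>))"
  have cob: "constant_on_blocks ?J (map \<sigma> (u @ v) @ (u @ v)) \<longleftrightarrow>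
      constant_on_blocks \<pi> (map \<sigma> u @ u) \<and> constant_on_blocks \<rho> (map \<sigma> v @ v)"
    if "u \<in> tuples n a" "v \<in> tuples n b" for u v
    using constant_on_blocks_juxtapose[of \<pi> a \<rho> b "map \<sigma> u" u "map \<sigma> v" v] that assms
    by (simp add: tuples_def partition_on_def)
  have "bij_betw (\<lambda>(u, v). u @ v)
      (twisted_fixed_words n \<sigma> (a, \<pi>) \<times> twisted_fixed_words n \<sigma> (b, \<rho>))
      {w \<in> tuples n (a + b). constant_on_blocks ?J (map \<sigma> w @ w)}"
    unfolding bij_betw_def
  proof
    show "inj_on (\<lambda>(u, v). u @ v)
        (twisted_fixed_words n \<sigma> (a, \<pi>) \<times> twisted_fixed_words n \<sigma> (b, \<rho>))"
      by (auto simp: inj_on_def twisted_fixed_words_def tuples_def)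
    have "tuples n (a + b) = (\<lambda>(u, v). u @ v) ` (tuples n a \<times> tuples n b)"
      using tuples_append[of n a b] by (simp add: bij_betw_def)
    then show "(\<lambda>(u, v). u @ v) ` (twisted_fixed_words n \<sigma> (a, \<pi>) \<times> twisted_fixed_words n \<sigma> (b, \<rho>))
        = {w \<in> tuples n (a + b). constant_on_blocks ?J (map \<sigma> w @ w)}"
      using cob by (auto simp: twisted_fixed_words_def simp del: juxtapose.simps map_append append_assoc)
  qed
  then have "card (twisted_fixed_words n \<sigma> (a, \<pi>) \<times> twisted_fixed_words n \<sigma> (b, \<rho>))
      = card {w \<in> tuples n (a + b). constant_on_blocks ?J (map \<sigma> w @ w)}"
    by (rule bij_betw_same_card)
  then show ?thesis
    by (simp add: card_cartesian_product twisted_fixed_words_def)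
qed

lemma foldr_juxtapose:
  assumes "\<forall>(a, \<pi>)\<in>set ds. partition_on {1..2 * a} \<pi>"
  shows "fst (foldr juxtapose ds (0, {})) = sum_list (map fst ds) \<and>
    partition_on {1..2 * sum_list (map fst ds)} (snd (foldr juxtapose ds (0, {}))) \<and>
    card (twisted_fixed_words n \<sigma> (foldr juxtapose ds (0, {}))) =
      prod_list (map (\<lambda>d. card (twisted_fixed_words n \<sigma> d)) ds)"
  using assms
proof (induction ds)
  case Nil
  have "twisted_fixed_words n \<sigma> (0, {}) = {[]}"
    by (auto simp: twisted_fixed_words_def tuples_def constant_on_blocks_def)
  then show ?case
    by (simp add: partition_on_empty)
next
  case (Cons d ds)
  obtain a \<pi> where d: "d = (a, \<pi>)"
    by (cases d)
  obtain b \<rho> where fold: "foldr juxtapose ds (0, {}) = (b, \<rho>)"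
    by fastforce
  have "partition_on {1..2 * a} \<pi>" "partition_on {1..2 * b} \<rho>" "b = sum_list (map fst ds)"
    "card (twisted_fixed_words n \<sigma> (b, \<rho>)) = prod_list (map (\<lambda>d. card (twisted_fixed_words n \<sigma> d)) ds)"
    using Cons d fold by auto
  then show ?case
    using partition_on_juxtapose[of a \<pi> b \<rho>] card_twisted_fixed_words_juxtapose[of a \<pi> b \<rho> n \<sigma>]
    by (simp add: d fold del: juxtapose.simps) simp
qed

lemma partition_on_cycle_dgm:
  assumes "r \<ge> 1"
  shows "partition_on {1..2 * r} (cycle_dgm r)"
proof (rule partition_onI)
  show "\<Union>(cycle_dgm r) = {1..2 * r}"
  proof
    show "\<Union>(cycle_dgm r) \<subseteq> {1..2 * r}"
      using assms by (auto simp: cycle_dgm_def)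
    show "{1..2 * r} \<subseteq> \<Union>(cycle_dgm r)"
    proof
      fix x assume x: "x \<in> {1..2 * r}"
      have "x < r \<or> x = r \<or> x = r + 1 \<or> (\<exists>i. x = r + (i + 1) \<and> 1 \<le> i \<and> i < r)"
        using x by (cases "x \<le> r + 1") (auto intro!: exI[of _ "x - r - 1"])
      moreover have "{i, r + (i + 1)} \<in> cycle_dgm r" if "1 \<le> i" "i < r" for i
        using that unfolding cycle_dgm_def by blast
      moreover have "{r, r + 1} \<in> cycle_dgm r"
        unfolding cycle_dgm_def by blast
      moreover have "1 \<le> x"
        using x by simp
      ultimately show "x \<in> \<Union>(cycle_dgm r)"
        by blast
    qed
  qed
  show "{} \<notin> cycle_dgm r"
    by (auto simp: cycle_dgm_def)
  show "disjnt p q" if "p \<in> cycle_dgm r" "q \<in> cycle_dgm r" "p \<noteq> q" for p q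
    using that by (auto simp: cycle_dgm_def disjnt_def)
qed

lemma constant_on_blocks_cycle_dgm:
  assumes "length w = r" "r \<ge> 1"
  shows "constant_on_blocks (cycle_dgm r) (map \<sigma> w @ w) \<longleftrightarrow>
    (\<forall>i. Suc i < r \<longrightarrow> \<sigma> (w ! i) = w ! Suc i) \<and> \<sigma> (w ! (r - 1)) = w ! 0"
proof -
  have edge: "constant_on_blocks {{i, r + j}} (map \<sigma> w @ w) \<longleftrightarrow> \<sigma> (w ! (i - 1)) = w ! (j - 1)"
    if "1 \<le> i" "i \<le> r" "1 \<le> j" "j \<le> r" for i j
    using that assms by (auto simp: constant_on_blocks_def nth_append)
  have "constant_on_blocks (cycle_dgm r) (map \<sigma> w @ w) \<longleftrightarrow>
    (\<forall>i. 1 \<le> i \<and> i < r \<longrightarrow> constant_on_blocks {{i, r + (i + 1)}} (map \<sigma> w @ w)) \<and>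
    constant_on_blocks {{r, r + 1}} (map \<sigma> w @ w)"
  proof -
    have "constant_on_blocks (cycle_dgm r) (map \<sigma> w @ w) \<longleftrightarrow>
        (\<forall>B\<in>cycle_dgm r. constant_on_blocks {B} (map \<sigma> w @ w))"
      by (simp add: constant_on_blocks_def)
    then show ?thesis
      unfolding cycle_dgm_def by blast
  qed
  also have "\<dots> \<longleftrightarrow> (\<forall>i. 1 \<le> i \<and> i < r \<longrightarrow> \<sigma> (w ! (i - 1)) = w ! i) \<and> \<sigma> (w ! (r - 1)) = w ! 0"
  proof -
    have "constant_on_blocks {{i, r + (i + 1)}} (map \<sigma> w @ w) \<longleftrightarrow> \<sigma> (w ! (i - 1)) = w ! i"
      if "1 \<le> i \<and> i < r" for i
      using edge[of i "i + 1"] that by simp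
    moreover have "constant_on_blocks {{r, r + 1}} (map \<sigma> w @ w) \<longleftrightarrow> \<sigma> (w ! (r - 1)) = w ! 0"
      using edge[of r 1] assms by simp
    ultimately show ?thesis
      by blast
  qed
  also have "\<dots> \<longleftrightarrow> (\<forall>i. Suc i < r \<longrightarrow> \<sigma> (w ! i) = w ! Suc i) \<and> \<sigma> (w ! (r - 1)) = w ! 0"
    by (auto simp: Suc_le_eq dest!: gr0_implies_Suc)
  finally show ?thesis .
qed

text \<open>
  By \<open>constant_on_blocks_cycle_dgm\<close> such a word is the sequence \<open>x, \<sigma> x, \<dots>, \<sigma>\<^sup>r\<^sup>-\<^sup>1 x\<close>, where the block that joins the last
  bottom vertex to the first top vertex says that \<open>\<sigma>\<^sup>r x = x\<close>; its first letter determines it.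
\<close>
lemma card_twisted_fixed_words_cycle:
  assumes r: "r \<ge> 1" and \<sigma>: "\<sigma> \<in> Sym n"
  shows "card (twisted_fixed_words n \<sigma> (r, cycle_dgm r)) = fixpts n (\<sigma> ^^ r)"
  unfolding fixpts_def
proof (rule bij_betw_same_card, rule bij_betw_byWitness)
  let ?iter = "\<lambda>x. map (\<lambda>i. (\<sigma> ^^ i) x) [0..<r]"
  let ?W = "twisted_fixed_words n \<sigma> (r, cycle_dgm r)" and ?F = "{i \<in> {1..n}. (\<sigma> ^^ r) i = i}"
  have W: "w \<in> ?W \<longleftrightarrow> w \<in> tuples n r \<and> (\<forall>i. Suc i < r \<longrightarrow> \<sigma> (w ! i) = w ! Suc i) \<and> \<sigma> (w ! (r - 1)) = w ! 0" for w
    using constant_on_blocks_cycle_dgm[of w r \<sigma>] r by (auto simp: twisted_fixed_words_def tuples_def)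
  have nth: "w ! i = (\<sigma> ^^ i) (w ! 0)" if "w \<in> ?W" "i < r" for w i
    using that(2)
  proof (induction i)
    case (Suc i)
    then show ?case
      using that(1) by (auto simp: W)
  qed simp
  show "\<forall>w\<in>?W. ?iter (w ! 0) = w"
  proof
    fix w assume w: "w \<in> ?W"
    then have "length w = r"
      by (simp add: W tuples_def)
    then show "?iter (w ! 0) = w"
      by (intro nth_equalityI) (simp_all add: nth[OF w, symmetric])
  qed
  show "\<forall>x\<in>?F. ?iter x ! 0 = x"
    using r by simp
  show "(\<lambda>w. w ! 0) ` ?W \<subseteq> ?F"
  proof clarify
    fix w assume w: "w \<in> ?W"
    have "w ! 0 \<in> set w"
      using w r by (auto simp: W tuples_def)
    moreover have "(\<sigma> ^^ r) (w ! 0) = \<sigma> (w ! (r - 1))"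
      using nth[OF w, of "r - 1"] r by (cases r) auto
    ultimately show "w ! 0 \<in> {1..n} \<and> (\<sigma> ^^ r) (w ! 0) = w ! 0"
      using w by (auto simp: W tuples_def)
  qed
  show "?iter ` ?F \<subseteq> ?W"
  proof clarify
    fix x assume x: "x \<in> {1..n}" "(\<sigma> ^^ r) x = x"
    have "(\<sigma> ^^ i) x \<in> {1..n}" for i
      using x(1) Sym_image[OF \<sigma>] by (induction i) auto
    moreover have "\<sigma> ((\<sigma> ^^ (r - 1)) x) = x"
      using x(2) r by (cases r) auto
    ultimately show "?iter x \<in> ?W"
      using r by (auto simp: W tuples_def)
  qed
qed

lemma card_twisted_fixed_words_gamma:
  assumes mu: "is_partition l mu" and "l \<le> k"
  shows "partition_on {1..2 * k} (gamma_dgm k mu)"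
    "\<sigma> \<in> Sym n \<Longrightarrow> card (twisted_fixed_words n \<sigma> (k, gamma_dgm k mu)) = n ^ (k - l) * fixpts_part n mu \<sigma>"
proof -
  let ?ds = "map (\<lambda>r. (r, cycle_dgm r)) mu @ replicate (k - sum_list mu) (1, {{1}, {2}})"
  have pos: "r \<ge> 1" if "r \<in> set mu" for r
    using mu that by (auto simp: is_partition_def Suc_le_eq)
  have dot: "partition_on {1..2 * 1} {{1}, {2 :: nat}}"
    by (auto simp: partition_on_def disjoint_def)
  have ds: "\<forall>(a, \<pi>)\<in>set ?ds. partition_on {1..2 * a} \<pi>"
  proof -
    have "partition_on {1..2 * r} (cycle_dgm r)" if "r \<in> set mu" for r
      using pos[OF that] by (rule partition_on_cycle_dgm)
    then show ?thesis
      using dot by auto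
  qed
  have free: "card (twisted_fixed_words n \<sigma> (1, {{1}, {2}})) = n" for \<sigma>
  proof -
    have "twisted_fixed_words n \<sigma> (1, {{1}, {2}}) = (\<lambda>x. [x]) ` {1..n}"
      by (auto simp: twisted_fixed_words_def tuples_def constant_on_blocks_def length_Suc_conv)
    then show ?thesis
      by (simp add: card_image inj_on_def)
  qed
  have cyc: "prod_list (map (\<lambda>r. card (twisted_fixed_words n \<sigma> (r, cycle_dgm r))) mu) = fixpts_part n mu \<sigma>"
    if "\<sigma> \<in> Sym n" for \<sigma>
    using pos that by (simp add: card_twisted_fixed_words_cycle fixpts_part_def cong: map_cong)
  have sum: "sum_list (map fst ?ds) = k"
    using mu \<open>l \<le> k\<close> by (simp add: is_partition_def comp_def sum_list_replicate)
  have fold: "foldr juxtapose ?ds (0, {}) = (k, gamma_dgm k mu)"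
    using foldr_juxtapose[OF ds] sum by (simp add: gamma_dgm_def prod_eq_iff)
  show "partition_on {1..2 * k} (gamma_dgm k mu)"
    using foldr_juxtapose[OF ds] unfolding fold sum by simp
  assume \<sigma>: "\<sigma> \<in> Sym n"
  have "card (twisted_fixed_words n \<sigma> (k, gamma_dgm k mu)) = prod_list (map (\<lambda>d. card (twisted_fixed_words n \<sigma> d)) ?ds)"
    using foldr_juxtapose[OF ds] unfolding fold by blast
  also have "\<dots> = fixpts_part n mu \<sigma> * n ^ (k - sum_list mu)"
    unfolding map_append prod_list.append map_map comp_def cyc[OF \<sigma>] map_replicate free prod_list_replicate ..
  finally show "card (twisted_fixed_words n \<sigma> (k, gamma_dgm k mu)) = n ^ (k - l) * fixpts_part n mu \<sigma>"
    using mu by (simp add: is_partition_def)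
qed

section \<open>Permutations of a given cycle type\<close>

text \<open>
  The cycle type, fixed points included, of a permutation of an arbitrary finite set: removing a
  cycle leaves a permutation of a smaller set, not of an initial segment of the integers.
\<close>
definition cycle_lengths :: "('a \<Rightarrow> 'a) \<Rightarrow> 'a set \<Rightarrow> nat multiset" where
  "cycle_lengths \<sigma> S = image_mset card (mset_set (orbit \<sigma> ` S))"

lemma count_cycle_lengths:
  assumes "finite S"
  shows "count (cycle_lengths \<sigma> S) i = card {C \<in> orbit \<sigma> ` S. card C = i}"
proof -
  have "count (cycle_lengths \<sigma> S) i = (\<Sum>C | C \<in> orbit \<sigma> ` S \<and> i = card C. count (mset_set (orbit \<sigma> ` S)) C)"
    unfolding cycle_lengths_def using assms by (simp add: count_image_mset')
  also have "\<dots> = (\<Sum>C | C \<in> orbit \<sigma> ` S \<and> i = card C. 1)"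
    using assms by (intro sum.cong) auto
  finally show ?thesis
    by (simp add: eq_commute[of i])
qed

lemma self_in_orbit: "finite S \<Longrightarrow> \<sigma> permutes S \<Longrightarrow> x \<in> orbit \<sigma> x"
  using permutation_permutes permutation_self_in_orbit by metis

lemma orbit_eq:
  assumes "finite S" "\<sigma> permutes S" "z \<in> orbit \<sigma> x"
  shows "orbit \<sigma> z = orbit \<sigma> x"
  using assms cyclic_on_orbit'[of \<sigma> x] permutation_permutes
  unfolding cyclic_on_alldef by metis

lemma orbits_partition:
  assumes "finite S" "\<sigma> permutes S"
  shows "partition_on S (orbit \<sigma> ` S)"
proof (rule partition_onI)
  show "\<Union>(orbit \<sigma> ` S) = S"
    using permutes_orbit_subset[OF assms(2)] self_in_orbit[OF assms] by blast
  show "disjnt p q" if "p \<in> orbit \<sigma> ` S" "q \<in> orbit \<sigma> ` S" "p \<noteq> q" for p q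
  proof -
    have "orbit \<sigma> z = p" "orbit \<sigma> z = q" if "z \<in> p" "z \<in> q" for z
      using \<open>p \<in> orbit \<sigma> ` S\<close> \<open>q \<in> orbit \<sigma> ` S\<close> that orbit_eq[OF assms] by blast+
    then show ?thesis
      using \<open>p \<noteq> q\<close> unfolding disjnt_iff by blast
  qed
  show "{} \<notin> orbit \<sigma> ` S"
    using self_in_orbit[OF assms] by blast
qed

lemma cycle_of_list_nth:
  assumes "distinct xs" "i < length xs"
  shows "cycle_of_list xs (xs ! i) = xs ! (Suc i mod length xs)"
proof -
  have "cycle_of_list xs (xs ! i) = map (cycle_of_list xs ^^ 1) xs ! i"
    using assms(2) by simp
  also have "\<dots> = rotate1 xs ! i"
    unfolding cyclic_rotation[OF assms(1)] by simp
  finally show ?thesis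
    using assms(2) by (simp add: nth_rotate1)
qed

lemma cycle_of_list_comp:
  assumes "\<tau> permutes (S - set xs)"
  shows "x \<in> set xs \<Longrightarrow> (cycle_of_list xs \<circ> \<tau>) x = cycle_of_list xs x"
    "x \<notin> set xs \<Longrightarrow> (cycle_of_list xs \<circ> \<tau>) x = \<tau> x"
proof -
  show "x \<in> set xs \<Longrightarrow> (cycle_of_list xs \<circ> \<tau>) x = cycle_of_list xs x"
    using permutes_not_in[OF assms, of x] by simp
  assume "x \<notin> set xs"
  then have "\<tau> x \<notin> set xs"
    using permutes_in_image[OF assms, of x] permutes_not_in[OF assms, of x] by (cases "x \<in> S") auto
  then show "(cycle_of_list xs \<circ> \<tau>) x = \<tau> x"
    by (simp add: id_outside_supp)
qed

lemma cycle_of_list_comp_permutes: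
  assumes "\<tau> permutes (S - set xs)" "set xs \<subseteq> S"
  shows "(cycle_of_list xs \<circ> \<tau>) permutes S"
  using assms cycle_permutes[of xs]
  by (intro permutes_compose) (auto intro: permutes_subset)

text \<open>
  The first entry runs through the list, so both the list and the permutation \<open>\<tau>\<close> can be recovered
  from the product together with the first entry.
\<close>
lemma cycle_of_list_comp_funpow:
  assumes "\<tau> permutes (S - set xs)" "distinct xs" "xs \<noteq> []"
  shows "((cycle_of_list xs \<circ> \<tau>) ^^ i) (hd xs) = xs ! (i mod length xs)"
proof (induction i)
  case 0
  then show ?case
    using assms(3) by (simp add: hd_conv_nth)
next
  case (Suc i)
  have "xs ! (i mod length xs) \<in> set xs"
    using assms(3) by simp
  then have "(cycle_of_list xs \<circ> \<tau>) (xs ! (i mod length xs)) = xs ! (Suc i mod length xs)"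
    using assms(2,3) cycle_of_list_comp(1)[OF assms(1)] by (simp only: cycle_of_list_nth mod_Suc_eq
        mod_less_divisor length_greater_0_conv not_False_eq_True)
  then show ?case
    using Suc by simp
qed

lemma orbit_cycle_of_list_comp_hd:
  assumes "\<tau> permutes (S - set xs)" "distinct xs" "xs \<noteq> []"
  shows "orbit (cycle_of_list xs \<circ> \<tau>) (hd xs) = set xs"
proof -
  have "orbit (cycle_of_list xs \<circ> \<tau>) (hd xs) = {xs ! (i mod length xs) | i. 0 < i}"
    unfolding orbit_altdef cycle_of_list_comp_funpow[OF assms] ..
  also have "\<dots> = set xs"
  proof
    show "set xs \<subseteq> {xs ! (i mod length xs) | i. 0 < i}"
    proof
      fix x assume "x \<in> set xs"
      then obtain i where "i < length xs" "x = xs ! i"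
        by (metis in_set_conv_nth)
      then show "x \<in> {xs ! (i mod length xs) | i. 0 < i}"
        \<comment> \<open>An orbit consists of positive powers; a full turn is added to reach \<open>i = 0\<close>.\<close>
        using assms(3) by (intro CollectI exI[of _ "i + length xs"]) simp
    qed
  qed (use assms(3) in auto)
  finally show ?thesis .
qed

lemma cycle_lengths_cycle_of_list_comp:
  assumes "finite S" "\<tau> permutes (S - set xs)" "set xs \<subseteq> S" "distinct xs" "xs \<noteq> []"
  shows "cycle_lengths (cycle_of_list xs \<circ> \<tau>) S = add_mset (length xs) (cycle_lengths \<tau> (S - set xs))"
proof -
  let ?\<sigma> = "cycle_of_list xs \<circ> \<tau>"
  have \<sigma>: "?\<sigma> permutes S"
    using assms by (intro cycle_of_list_comp_permutes)
  have in_xs: "orbit ?\<sigma> z = set xs" if "z \<in> set xs" for z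
    using orbit_eq[OF assms(1) \<sigma>, of z "hd xs"] that
    unfolding orbit_cycle_of_list_comp_hd[OF assms(2,4,5)] .
  have off_xs: "orbit ?\<sigma> z = orbit \<tau> z" if "z \<in> S - set xs" for z
    using that cycle_of_list_comp(2)[OF assms(2)] permutes_in_image[OF assms(2)]
    by (intro orbit_cong0[where A = "S - set xs", symmetric]) auto
  have "orbit ?\<sigma> ` S = orbit ?\<sigma> ` set xs \<union> orbit ?\<sigma> ` (S - set xs)"
    using assms(3) by blast
  also have "\<dots> = insert (set xs) (orbit \<tau> ` (S - set xs))"
    using in_xs off_xs assms(5) by (auto simp: image_iff)
  finally have orbits: "orbit ?\<sigma> ` S = insert (set xs) (orbit \<tau> ` (S - set xs))" .
  moreover have "set xs \<notin> orbit \<tau> ` (S - set xs)"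
    using self_in_orbit[OF _ assms(2)] assms(1) by auto
  ultimately show ?thesis
    using assms by (simp add: cycle_lengths_def distinct_card)
qed

text \<open>
  The list is the orbit of \<open>y\<close> written in the order in which \<open>\<sigma>\<close> visits it, and \<open>\<tau>\<close> is the
  restriction of \<open>\<sigma>\<close> to the complement of that orbit.
\<close>
lemma split_off_cycle:
  assumes "finite S" "\<sigma> permutes S" "y \<in> S"
  obtains xs \<tau> where "distinct xs" "xs \<noteq> []" "hd xs = y" "set xs \<subseteq> S" "length xs = card (orbit \<sigma> y)"
    "\<tau> permutes (S - set xs)" "\<sigma> = cycle_of_list xs \<circ> \<tau>"
proof -
  define r where "r = funpow_dist1 \<sigma> y y"
  define xs where "xs = map (\<lambda>i. (\<sigma> ^^ i) y) [0..<r]"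
  have y: "y \<in> orbit \<sigma> y"
    using assms(1,2) by (rule self_in_orbit)
  have per: "(\<sigma> ^^ r) y = y"
    unfolding r_def using y by (rule funpow_dist1_prop)
  have "r > 0"
    by (simp add: r_def)
  have set: "set xs = orbit \<sigma> y"
    using orbit_conv_funpow_dist1[OF y] by (simp only: xs_def r_def set_map set_upt)
  have dist: "distinct xs"
    using inj_on_funpow_dist1[OF y] by (simp only: xs_def r_def distinct_map distinct_upt set_upt simp_thms)
  have "permutation \<sigma>"
    using assms permutation_permutes by blast
  define \<tau> where "\<tau> = perm_restrict \<sigma> (S - set xs)"
  have \<tau>: "\<tau> permutes (S - set xs)"
    unfolding \<tau>_def set using assms(2) cyclic_on_orbit'[OF \<open>permutation \<sigma>\<close>]
    by (rule perm_restrict_diff_cyclic)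
  have "\<sigma> x = (cycle_of_list xs \<circ> \<tau>) x" for x
  proof (cases "x \<in> set xs")
    case True
    then obtain i where i: "i < r" "x = xs ! i"
      by (metis in_set_conv_nth xs_def length_map length_upt diff_zero)
    have "\<sigma> x = xs ! (Suc i mod r)"
    proof -
      have "\<sigma> x = (\<sigma> ^^ Suc i) y"
        using i by (simp add: xs_def)
      also have "\<dots> = xs ! (Suc i mod r)"
        using i \<open>r > 0\<close> per
        by (cases "Suc i = r") (simp_all add: xs_def del: funpow.simps add: funpow_0)
      finally show ?thesis .
    qed
    moreover have "cycle_of_list xs x = xs ! (Suc i mod r)"
      using cycle_of_list_nth[OF dist, of i] i by (simp add: xs_def)
    ultimately show ?thesis
      using True cycle_of_list_comp(1)[OF \<tau>] by simp
  next
    case False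
    have "\<sigma> x = \<tau> x"
      using False permutes_not_in[OF assms(2)] by (auto simp: \<tau>_def perm_restrict_def)
    then show ?thesis
      using cycle_of_list_comp(2)[OF \<tau> False] by (rule trans[OF _ sym])
  qed
  moreover have "xs \<noteq> []" "hd xs = y"
    using \<open>r > 0\<close> by (auto simp: xs_def hd_map)
  moreover have "set xs \<subseteq> S"
    unfolding set using assms(2,3) by (rule permutes_orbit_subset)
  moreover have "length xs = card (orbit \<sigma> y)"
    using dist by (simp add: set[symmetric] distinct_card)
  ultimately show ?thesis
    using that dist \<tau> by blast
qed

lemma card_in_cycles_of_length:
  assumes "finite S" "\<sigma> permutes S"
  shows "card {y \<in> S. card (orbit \<sigma> y) = r} = r * count (cycle_lengths \<sigma> S) r"
proof -
  let ?O = "{C \<in> orbit \<sigma> ` S. card C = r}"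
  have part: "partition_on S (orbit \<sigma> ` S)"
    using assms by (rule orbits_partition)
  have "{y \<in> S. card (orbit \<sigma> y) = r} = \<Union>?O"
  proof
    show "{y \<in> S. card (orbit \<sigma> y) = r} \<subseteq> \<Union>?O"
      using self_in_orbit[OF assms] by blast
    show "\<Union>?O \<subseteq> {y \<in> S. card (orbit \<sigma> y) = r}"
    proof clarify
      fix y x assume *: "x \<in> S" "y \<in> orbit \<sigma> x" "r = card (orbit \<sigma> x)"
      then have "y \<in> S"
        using permutes_orbit_subset[OF assms(2)] by blast
      moreover have "orbit \<sigma> y = orbit \<sigma> x"
        using assms *(2) by (rule orbit_eq)
      ultimately show "y \<in> S \<and> card (orbit \<sigma> y) = card (orbit \<sigma> x)"
        by simp
    qed
  qed
  also have "card (\<Union>?O) = sum card ?O"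
  proof (rule card_Union_disjoint)
    show "pairwise disjnt ?O"
      using partition_onD2[OF part] by (rule pairwise_subset) auto
    show "finite C" if "C \<in> ?O" for C
      using that permutes_orbit_subset[OF assms(2)] finite_subset[OF _ assms(1)] by auto
  qed
  finally show ?thesis
    using assms by (simp add: count_cycle_lengths)
qed

definition cycle_class :: "'a set \<Rightarrow> nat multiset \<Rightarrow> ('a \<Rightarrow> 'a) set" where
  "cycle_class S M = {\<sigma>. \<sigma> permutes S \<and> cycle_lengths \<sigma> S = M}"

lemma finite_cycle_class: "finite S \<Longrightarrow> finite (cycle_class S M)"
  unfolding cycle_class_def by (rule finite_subset[OF _ finite_permutations]) auto

text \<open>
  Marking a point \<open>y\<close> on a cycle of length \<open>r\<close> is the same as writing that cycle as a list that
  starts with \<open>y\<close> and keeping the rest of the permutation.  Counting both sides gives the recursion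
  for the sizes of the classes.
\<close>
lemma split_off_cycle_bij:
  assumes "finite S" "r \<ge> 1"
  shows "bij_betw (\<lambda>(xs, \<tau>). (cycle_of_list xs \<circ> \<tau>, hd xs))
    (SIGMA xs:{xs. length xs = r \<and> distinct xs \<and> set xs \<subseteq> S}. cycle_class (S - set xs) M)
    (SIGMA \<sigma>:cycle_class S (add_mset r M). {y \<in> S. card (orbit \<sigma> y) = r})"
    (is "bij_betw ?h ?X ?Y")
  unfolding bij_betw_def
proof
  have ne: "xs \<noteq> []" if "length xs = r" for xs :: "'a list"
    using that assms(2) by auto
  show "inj_on ?h ?X"
  proof (rule inj_onI)
    fix p p' assume X: "p \<in> ?X" "p' \<in> ?X" and "?h p = ?h p'"
    obtain xs \<tau> xs' \<tau>' where p: "p = (xs, \<tau>)" "p' = (xs', \<tau>')"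
      by (cases p, cases p')
    have xs: "length xs = r" "distinct xs" and xs': "length xs' = r" "distinct xs'"
      and \<tau>: "\<tau> permutes (S - set xs)" and \<tau>': "\<tau>' permutes (S - set xs')"
      using X by (auto simp: p cycle_class_def)
    have eq: "cycle_of_list xs \<circ> \<tau> = cycle_of_list xs' \<circ> \<tau>'" and hd: "hd xs = hd xs'"
      using \<open>?h p = ?h p'\<close> by (auto simp: p)
    have "xs \<noteq> []" "xs' \<noteq> []"
      using ne xs xs' by auto
    have "xs ! i = xs' ! i" if "i < length xs" for i
      using cycle_of_list_comp_funpow[OF \<tau> xs(2) \<open>xs \<noteq> []\<close>, of i]
        cycle_of_list_comp_funpow[OF \<tau>' xs'(2) \<open>xs' \<noteq> []\<close>, of i] that eq hd xs(1) xs'(1) by simp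
    then have "xs = xs'"
      using xs(1) xs'(1) by (auto intro: nth_equalityI)
    moreover have "\<tau> x = \<tau>' x" for x
    proof (cases "x \<in> set xs")
      case True
      then show ?thesis
        using \<open>xs = xs'\<close> permutes_not_in[OF \<tau>, of x] permutes_not_in[OF \<tau>', of x] by simp
    next
      case False
      have "\<tau> x = (cycle_of_list xs \<circ> \<tau>) x"
        using cycle_of_list_comp(2)[OF \<tau> False] ..
      also have "\<dots> = \<tau>' x"
        unfolding eq using False \<open>xs = xs'\<close> by (intro cycle_of_list_comp(2)[OF \<tau>']) simp
      finally show ?thesis .
    qed
    ultimately show "p = p'"
      by (auto simp: p)
  qed
  show "?h ` ?X = ?Y"
  proof
    show "?h ` ?X \<subseteq> ?Y"
    proof (rule image_subsetI)
      fix p assume X: "p \<in> ?X"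
      obtain xs \<tau> where p: "p = (xs, \<tau>)"
        by (cases p)
      have xs: "length xs = r" "distinct xs" "set xs \<subseteq> S"
        and \<tau>: "\<tau> permutes (S - set xs)" "cycle_lengths \<tau> (S - set xs) = M"
        using X by (auto simp: p cycle_class_def)
      have "xs \<noteq> []"
        using ne xs by auto
      show "?h p \<in> ?Y"
        using cycle_of_list_comp_permutes[OF \<tau>(1) xs(3)] \<open>xs \<noteq> []\<close> xs \<tau>(2) distinct_card[OF xs(2)]
          cycle_lengths_cycle_of_list_comp[OF assms(1) \<tau>(1) xs(3,2) \<open>xs \<noteq> []\<close>]
          orbit_cycle_of_list_comp_hd[OF \<tau>(1) xs(2) \<open>xs \<noteq> []\<close>]
        by (auto simp: p cycle_class_def)
    qed
    show "?Y \<subseteq> ?h ` ?X"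
    proof
      fix p assume Y: "p \<in> ?Y"
      obtain \<sigma> y where p: "p = (\<sigma>, y)"
        by (cases p)
      have \<sigma>: "\<sigma> permutes S" "cycle_lengths \<sigma> S = add_mset r M" and y: "y \<in> S" "r = card (orbit \<sigma> y)"
        using Y by (auto simp: p cycle_class_def)
      obtain xs \<tau> where xs: "distinct xs" "xs \<noteq> []" "hd xs = y" "set xs \<subseteq> S" "length xs = card (orbit \<sigma> y)"
        and \<tau>: "\<tau> permutes (S - set xs)" "\<sigma> = cycle_of_list xs \<circ> \<tau>"
        using split_off_cycle[OF assms(1) \<sigma>(1) y(1)] by blast
      have "cycle_lengths \<tau> (S - set xs) = M"
        using cycle_lengths_cycle_of_list_comp[OF assms(1) \<tau>(1) xs(4,1,2)] \<sigma>(2) \<tau>(2) xs(5) y(2) by simp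
      then show "p \<in> ?h ` ?X"
        using xs \<tau> y(2) by (intro image_eqI[of _ _ "(xs, \<tau>)"]) (auto simp: p cycle_class_def)
    qed
  qed
qed

text \<open>
  Each permutation on one side of the bijection has \<open>r\<close> times (number of its \<open>r\<close>-cycles) marked
  points; on the other side there are \<open>|S|! / (|S| - r)!\<close> lists, each with a class counted by the
  hypothesis.  The factor \<open>r * Suc (count M r)\<close> is the quotient of the two values of \<open>z\<close>, see
  \<open>zee_Cons\<close>.
\<close>
lemma card_cycle_class_add:
  fixes S :: "'a set"
  assumes "finite S" "r \<ge> 1" "r \<le> card S"
    and IH: "\<And>T :: 'a set. finite T \<Longrightarrow> card T = card S - r \<Longrightarrow> card (cycle_class T M) * z = fact (card T)"
  shows "card (cycle_class S (add_mset r M)) * (z * r * Suc (count M r)) = fact (card S)"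
proof -
  let ?L = "{xs. length xs = r \<and> distinct xs \<and> set xs \<subseteq> S}"
  have finL: "finite ?L"
    using finite_lists_length_eq[OF assms(1), of r] by (rule finite_subset[rotated]) auto
  have "card (SIGMA xs:?L. cycle_class (S - set xs) M) =
      card (SIGMA \<sigma>:cycle_class S (add_mset r M). {y \<in> S. card (orbit \<sigma> y) = r})"
    using split_off_cycle_bij[OF assms(1,2)] by (rule bij_betw_same_card)
  moreover have "card (SIGMA \<sigma>:cycle_class S (add_mset r M). {y \<in> S. card (orbit \<sigma> y) = r}) =
      card (cycle_class S (add_mset r M)) * (r * Suc (count M r))"
  proof -
    have "card {y \<in> S. card (orbit \<sigma> y) = r} = r * Suc (count M r)"
      if "\<sigma> \<in> cycle_class S (add_mset r M)" for \<sigma>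
      using that assms(1) by (simp add: cycle_class_def card_in_cycles_of_length)
    then show ?thesis
      using assms(1) by (simp add: card_SigmaI finite_cycle_class del: mult_Suc_right)
  qed
  moreover have "card (SIGMA xs:?L. cycle_class (S - set xs) M) =
      (\<Sum>xs\<in>?L. card (cycle_class (S - set xs) M))"
    using assms(1) finL by (intro card_SigmaI) (auto simp: finite_cycle_class)
  ultimately have "card (cycle_class S (add_mset r M)) * (r * Suc (count M r)) =
      (\<Sum>xs\<in>?L. card (cycle_class (S - set xs) M))"
    by metis
  then have "card (cycle_class S (add_mset r M)) * (r * Suc (count M r)) * z =
      (\<Sum>xs\<in>?L. card (cycle_class (S - set xs) M) * z)"
    by (simp only: sum_distrib_right)
  then have "card (cycle_class S (add_mset r M)) * (z * r * Suc (count M r)) =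
      (\<Sum>xs\<in>?L. card (cycle_class (S - set xs) M) * z)"
    by (simp only: mult_ac)
  also have "\<dots> = (\<Sum>xs\<in>?L. fact (card S - r))"
  proof (rule sum.cong)
    fix xs assume "xs \<in> ?L"
    then have "card (S - set xs) = card S - r"
      using assms(1) by (auto simp: card_Diff_subset distinct_card)
    then show "card (cycle_class (S - set xs) M) * z = fact (card S - r)"
      using IH[of "S - set xs"] assms(1) by simp
  qed simp
  also have "\<dots> = \<Prod>{card S - r + 1..card S} * fact (card S - r)"
    using card_lists_distinct_length_eq[OF assms(1,3)] by simp
  also have "\<dots> = fact (card S)"
    using fact_div_fact[of "card S - r" "card S"] fact_dvd[of "card S - r" "card S", where 'a = nat]
    by (metis diff_le_self dvd_div_mult_self Suc_eq_plus1)
  finally show ?thesis .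
qed

lemma zee_Cons:
  assumes "1 \<le> r" "r \<le> n"
  shows "zee n (r # \<delta>) = zee n \<delta> * r * Suc (count_list \<delta> r)"
proof -
  let ?f = "\<lambda>\<delta> i. i ^ count_list \<delta> i * fact (count_list \<delta> i) :: nat"
  have "zee n (r # \<delta>) = ?f (r # \<delta>) r * prod (?f (r # \<delta>)) ({1..n} - {r})"
    unfolding zee_def using assms by (intro prod.remove) auto
  also have "prod (?f (r # \<delta>)) ({1..n} - {r}) = prod (?f \<delta>) ({1..n} - {r})"
    by (intro prod.cong) auto
  also have "?f (r # \<delta>) r = ?f \<delta> r * (r * Suc (count_list \<delta> r))"
    by (simp add: algebra_simps)
  also have "\<dots> * prod (?f \<delta>) ({1..n} - {r}) = (?f \<delta> r * prod (?f \<delta>) ({1..n} - {r})) * (r * Suc (count_list \<delta> r))"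
    by (simp add: mult_ac)
  also have "?f \<delta> r * prod (?f \<delta>) ({1..n} - {r}) = zee n \<delta>"
    unfolding zee_def using assms by (intro prod.remove[symmetric]) auto
  finally show ?thesis
    by (simp only: mult.assoc)
qed

lemma card_cycle_class:
  assumes "finite S" "card S = sum_list \<delta>" "\<forall>r\<in>set \<delta>. 1 \<le> r \<and> r \<le> n"
  shows "card (cycle_class S (mset \<delta>)) * zee n \<delta> = fact (card S)"
  using assms
proof (induction \<delta> arbitrary: S)
  case Nil
  then have "cycle_class S {#} = {id}"
    by (auto simp: cycle_class_def cycle_lengths_def permutes_empty)
  then show ?case
    using Nil by (simp add: zee_def)
next
  case (Cons r \<delta>)
  have "card (cycle_class S (add_mset r (mset \<delta>))) * (zee n \<delta> * r * Suc (count (mset \<delta>) r)) = fact (card S)"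
  proof (rule card_cycle_class_add)
    fix T :: "'a set" assume "finite T" "card T = card S - r"
    then show "card (cycle_class T (mset \<delta>)) * zee n \<delta> = fact (card T)"
      using Cons.prems by (intro Cons.IH) auto
  qed (use Cons.prems in auto)
  then show ?case
    using Cons.prems by (simp add: zee_Cons count_mset del: mult_Suc_right)
qed

text \<open>
  One cycle of length \<open>r\<close> is removed from each permutation; the two removed lists are matched entry
  by entry, and the remaining permutations are matched by induction.
\<close>
lemma cycle_class_intertwine:
  fixes S S' :: "'a set"
  assumes "finite S" "finite S'" "\<sigma> \<in> cycle_class S M" "\<sigma>' \<in> cycle_class S' M"
  shows "\<exists>\<rho>. bij_betw \<rho> S S' \<and> (\<forall>x\<in>S. \<rho> (\<sigma> x) = \<sigma>' (\<rho> x))"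
  using assms
proof (induction M arbitrary: S S' \<sigma> \<sigma>')
  case empty
  then have "S = {}" "S' = {}"
    by (auto simp: cycle_class_def cycle_lengths_def mset_set_empty_iff)
  then show ?case
    by (simp add: bij_betw_def)
next
  case (add r M)
  have split: "\<exists>xs \<tau>. distinct xs \<and> length xs = r \<and> xs \<noteq> [] \<and> set xs \<subseteq> S \<and> \<tau> \<in> cycle_class (S - set xs) M
      \<and> \<tau> permutes (S - set xs) \<and> \<sigma> = cycle_of_list xs \<circ> \<tau>"
    if S: "finite S" and "\<sigma> \<in> cycle_class S (add_mset r M)" for S :: "'a set" and \<sigma>
  proof -
    from that have \<sigma>: "\<sigma> permutes S" "cycle_lengths \<sigma> S = add_mset r M"
      by (auto simp: cycle_class_def)
    then have "r \<in># cycle_lengths \<sigma> S"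
      by simp
    then obtain y where y: "y \<in> S" "card (orbit \<sigma> y) = r"
      using S by (auto simp: cycle_lengths_def)
    obtain xs \<tau> where xs: "distinct xs" "xs \<noteq> []" "hd xs = y" "set xs \<subseteq> S" "length xs = card (orbit \<sigma> y)"
      and \<tau>: "\<tau> permutes (S - set xs)" "\<sigma> = cycle_of_list xs \<circ> \<tau>"
      using split_off_cycle[OF S \<sigma>(1) y(1)] by blast
    have "cycle_lengths \<tau> (S - set xs) = M"
      using cycle_lengths_cycle_of_list_comp[OF S \<tau>(1) xs(4,1,2)] \<sigma>(2) \<tau>(2) xs(5) y(2) by simp
    then show ?thesis
      using xs \<tau> y by (intro exI[of _ xs] exI[of _ \<tau>]) (auto simp: cycle_class_def)
  qed
  obtain xs \<tau> where xs: "distinct xs" "length xs = r" "xs \<noteq> []" "set xs \<subseteq> S"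
    and \<tau>: "\<tau> \<in> cycle_class (S - set xs) M" "\<tau> permutes (S - set xs)" "\<sigma> = cycle_of_list xs \<circ> \<tau>"
    using split[OF add.prems(1,3)] by blast
  obtain xs' \<tau>' where xs': "distinct xs'" "length xs' = r" "xs' \<noteq> []" "set xs' \<subseteq> S'"
    and \<tau>': "\<tau>' \<in> cycle_class (S' - set xs') M" "\<tau>' permutes (S' - set xs')" "\<sigma>' = cycle_of_list xs' \<circ> \<tau>'"
    using split[OF add.prems(2,4)] by blast
  obtain \<rho> where \<rho>: "bij_betw \<rho> (S - set xs) (S' - set xs')" "\<forall>x\<in>S - set xs. \<rho> (\<tau> x) = \<tau>' (\<rho> x)"
    using add.IH[OF _ _ \<tau>(1) \<tau>'(1)] add.prems by auto
  define idx where "idx = inv_into {..<r} ((!) xs)"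
  have nth: "bij_betw ((!) xs) {..<r} (set xs)" "bij_betw ((!) xs') {..<r} (set xs')"
    using xs xs' by (auto intro!: bij_betw_nth)
  have idx_nth: "idx (xs ! i) = i" if "i < r" for i
    unfolding idx_def using that nth(1) by (simp add: bij_betw_def)
  define \<phi> where "\<phi> x = (if x \<in> set xs then xs' ! idx x else \<rho> x)" for x
  have "bij_betw (\<lambda>x. xs' ! idx x) (set xs) (set xs')"
    using bij_betw_trans[OF bij_betw_inv_into[OF nth(1)] nth(2)] by (simp add: idx_def comp_def)
  then have "bij_betw \<phi> (set xs) (set xs')"
    by (rule bij_betw_cong[THEN iffD1, rotated]) (simp add: \<phi>_def)
  moreover have "bij_betw \<phi> (S - set xs) (S' - set xs')"
    using \<rho>(1) by (rule bij_betw_cong[THEN iffD1, rotated]) (simp add: \<phi>_def)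
  ultimately have "bij_betw \<phi> (set xs \<union> (S - set xs)) (set xs' \<union> (S' - set xs'))"
    by (rule bij_betw_combine) auto
  then have "bij_betw \<phi> S S'"
    using xs(4) xs'(4) by (simp add: Un_absorb1)
  moreover have "\<phi> (\<sigma> x) = \<sigma>' (\<phi> x)" if "x \<in> S" for x
  proof (cases "x \<in> set xs")
    case True
    then obtain i where i: "i < r" "x = xs ! i"
      using xs(2) by (metis in_set_conv_nth)
    have r: "Suc i mod r < r"
      using i by simp
    have "\<sigma> x = xs ! (Suc i mod r)"
      using cycle_of_list_comp(1)[OF \<tau>(2) True] cycle_of_list_nth[OF xs(1)] i xs(2) \<tau>(3) by simp
    then have "\<phi> (\<sigma> x) = xs' ! (Suc i mod r)"
      using idx_nth[OF r] r xs(2) by (simp add: \<phi>_def)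
    moreover have "\<phi> x = xs' ! i"
      using True i idx_nth by (simp add: \<phi>_def)
    moreover have "\<sigma>' (xs' ! i) = xs' ! (Suc i mod r)"
      using cycle_of_list_comp(1)[OF \<tau>'(2), of "xs' ! i"] cycle_of_list_nth[OF xs'(1)] i xs'(2) \<tau>'(3) by simp
    ultimately show ?thesis
      by simp
  next
    case False
    then have x: "x \<in> S - set xs"
      using that by simp
    have "\<sigma> x = \<tau> x"
      using cycle_of_list_comp(2)[OF \<tau>(2) False] \<tau>(3) by simp
    moreover have "\<tau> x \<in> S - set xs"
      using permutes_in_image[OF \<tau>(2)] x by blast
    moreover have "\<rho> x \<in> S' - set xs'"
      using \<rho>(1) x by (rule bij_betwE[THEN bspec])
    then have "\<sigma>' (\<rho> x) = \<tau>' (\<rho> x)"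
      using cycle_of_list_comp(2)[OF \<tau>'(2)] \<tau>'(3) by simp
    ultimately show ?thesis
      using \<rho>(2) x False by (simp add: \<phi>_def)
  qed
  ultimately show ?case
    by blast
qed

lemma cycle_class_conjugate:
  assumes \<sigma>: "\<sigma> \<in> cycle_class {1..n} M" and \<sigma>': "\<sigma>' \<in> cycle_class {1..n} M"
  obtains \<rho> where "\<rho> \<in> Sym n" "\<sigma>' = \<rho> \<circ> \<sigma> \<circ> inv \<rho>"
proof -
  obtain \<phi> where \<phi>: "bij_betw \<phi> {1..n} {1..n}" "\<forall>x\<in>{1..n}. \<phi> (\<sigma> x) = \<sigma>' (\<phi> x)"
    using cycle_class_intertwine[OF _ _ assms] by auto
  \<comment> \<open>An element of the symmetric group has to fix the integers outside \<open>{1..n}\<close>.\<close>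
  define \<rho> where "\<rho> x = (if x \<in> {1..n} then \<phi> x else x)" for x
  have "bij_betw \<rho> {1..n} {1..n}"
    using \<phi>(1) by (rule bij_betw_cong[THEN iffD1, rotated]) (simp add: \<rho>_def)
  then have "\<rho> permutes {1..n}"
    by (rule bij_imp_permutes) (auto simp: \<rho>_def)
  then have \<rho>: "\<rho> \<in> Sym n"
    by (simp add: Sym_def)
  have perm: "\<sigma> permutes {1..n}" "\<sigma>' permutes {1..n}"
    using assms by (auto simp: cycle_class_def)
  have "\<rho> (\<sigma> x) = \<sigma>' (\<rho> x)" for x
    using \<phi>(2) permutes_in_image[OF perm(1), of x] permutes_not_in[OF perm(1), of x]
      permutes_not_in[OF perm(2), of x] by (auto simp: \<rho>_def)
  then have "\<sigma>' = \<rho> \<circ> \<sigma> \<circ> inv \<rho>"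
    by (simp add: fun_eq_iff Sym_inverses[OF \<rho>])
  with \<rho> show ?thesis
    using that by blast
qed

text \<open>
  The counts for the positive lengths decide: no orbit is empty and no part is zero.
\<close>
lemma has_cycle_type_iff:
  assumes "\<sigma> \<in> Sym n" "is_partition n \<delta>"
  shows "has_cycle_type n \<sigma> \<delta> \<longleftrightarrow> \<sigma> \<in> cycle_class {1..n} (mset \<delta>)"
proof -
  have \<sigma>: "\<sigma> permutes {1..n}"
    using assms(1) by (simp add: Sym_def)
  have "card (orbit \<sigma> x) \<noteq> 0" if "x \<in> {1..n}" for x
  proof -
    have "finite (orbit \<sigma> x)"
      using permutes_orbit_subset[OF \<sigma> that] by (rule finite_subset) simp
    then show ?thesis
      using self_in_orbit[OF _ \<sigma>, of x] by auto
  qed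
  then have "count (cycle_lengths \<sigma> {1..n}) 0 = 0"
    by (auto simp: count_cycle_lengths)
  moreover have "count (mset \<delta>) 0 = 0"
    using assms(2) by (auto simp: is_partition_def count_mset count_list_0_iff)
  moreover have "{C. (\<exists>x\<in>{1..n}. C = orbit \<sigma> x) \<and> card C = i} = {C \<in> orbit \<sigma> ` {1..n}. card C = i}" for i
    by auto
  ultimately have "has_cycle_type n \<sigma> \<delta> \<longleftrightarrow>
      (\<forall>i\<ge>1. count (cycle_lengths \<sigma> {1..n}) i = count (mset \<delta>) i)"
    and "count (cycle_lengths \<sigma> {1..n}) 0 = count (mset \<delta>) 0"
    by (simp_all only: has_cycle_type_def count_cycle_lengths finite_atLeastAtMost count_mset)
  moreover have "(\<forall>i\<ge>1. Q i) \<longleftrightarrow> (\<forall>i. Q i)" if "Q 0" for Q :: "nat \<Rightarrow> bool"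
    using that by (metis One_nat_def Suc_leI not_gr_zero)
  ultimately show ?thesis
    using \<sigma> by (simp add: cycle_class_def multiset_eq_iff)
qed

lemma mset_partition_inject:
  assumes "is_partition n \<delta>" "is_partition m \<delta>'" "mset \<delta> = mset \<delta>'"
  shows "\<delta> = \<delta>'"
proof -
  have "sorted (rev \<delta>)" "sorted (rev \<delta>')"
    using assms by (auto simp: is_partition_def sorted_wrt_rev)
  then have "rev \<delta> = rev \<delta>'"
    using assms(3) by (metis mset_rev properties_for_sort)
  then show ?thesis
    by simp
qed

lemma partition_of_permutation:
  assumes "\<sigma> \<in> Sym n"
  obtains \<delta> where "is_partition n \<delta>" "\<sigma> \<in> cycle_class {1..n} (mset \<delta>)"
proof -
  define \<delta> where "\<delta> = rev (sorted_list_of_multiset (cycle_lengths \<sigma> {1..n}))"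
  have \<sigma>: "\<sigma> permutes {1..n}"
    using assms by (simp add: Sym_def)
  have fin: "finite (orbit \<sigma> x)" if "x \<in> {1..n}" for x
    using permutes_orbit_subset[OF \<sigma> that] by (rule finite_subset) simp
  have mset: "mset \<delta> = cycle_lengths \<sigma> {1..n}"
    by (simp add: \<delta>_def)
  have part: "partition_on {1..n} (orbit \<sigma> ` {1..n})"
    using \<sigma> by (intro orbits_partition) auto
  have "sum_list \<delta> = sum_mset (cycle_lengths \<sigma> {1..n})"
    by (metis mset sum_mset_sum_list)
  also have "\<dots> = sum card (orbit \<sigma> ` {1..n})"
    by (simp add: cycle_lengths_def sum_unfold_sum_mset)
  also have "\<dots> = card (\<Union>(orbit \<sigma> ` {1..n}))"
    using partition_onD2[OF part] fin by (intro card_Union_disjoint[symmetric]) auto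
  finally have "sum_list \<delta> = n"
    using partition_onD1[OF part] by simp
  moreover have "set \<delta> = card ` orbit \<sigma> ` {1..n}"
    using arg_cong[OF mset, of set_mset] by (simp add: cycle_lengths_def)
  then have "\<forall>r\<in>set \<delta>. r > 0"
    using fin self_in_orbit[OF _ \<sigma>] by (fastforce simp: card_gt_0_iff)
  moreover have "sorted_wrt (\<ge>) \<delta>"
    by (simp add: \<delta>_def sorted_wrt_rev)
  ultimately show ?thesis
    using that[of \<delta>] \<sigma> mset by (simp add: is_partition_def cycle_class_def)
qed

text \<open>
  The class must be nonempty for the value to be determined, hence the permutation \<open>\<sigma>\<close> in it.
\<close>
lemma class_value_eq:
  assumes \<sigma>: "\<sigma> \<in> cycle_class {1..n} (mset \<delta>)" and \<delta>: "is_partition n \<delta>"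
    and f: "\<And>\<rho> \<sigma>. \<rho> \<in> Sym n \<Longrightarrow> \<sigma> \<in> Sym n \<Longrightarrow> f (\<rho> \<circ> \<sigma> \<circ> inv \<rho>) = f \<sigma>"
  shows "class_value n f \<delta> = f \<sigma>"
  unfolding class_value_def
proof (rule the_equality)
  have S: "\<sigma> \<in> Sym n"
    using \<sigma> by (simp add: cycle_class_def Sym_def)
  show "\<forall>\<sigma>'\<in>Sym n. has_cycle_type n \<sigma>' \<delta> \<longrightarrow> f \<sigma>' = f \<sigma>"
    using cycle_class_conjugate[OF \<sigma>] f[OF _ S] has_cycle_type_iff[OF _ \<delta>] by metis
  then show "c = f \<sigma>" if "\<forall>\<sigma>'\<in>Sym n. has_cycle_type n \<sigma>' \<delta> \<longrightarrow> f \<sigma>' = c" for c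
    using that S \<sigma> has_cycle_type_iff[OF _ \<delta>] by metis
qed

text \<open>
  The classes \<open>\<delta>\<close> partition the group, and each contributes its size \<open>n! / z\<^sub>\<delta>\<close> times the constant
  value there.
\<close>
lemma sum_class_functions:
  fixes f :: "(nat \<Rightarrow> nat) \<Rightarrow> nat" and g :: "(nat \<Rightarrow> nat) \<Rightarrow> 'f::field_char_0"
  assumes f: "\<And>\<rho> \<sigma>. \<rho> \<in> Sym n \<Longrightarrow> \<sigma> \<in> Sym n \<Longrightarrow> f (\<rho> \<circ> \<sigma> \<circ> inv \<rho>) = f \<sigma>"
    and g: "\<And>\<rho> \<sigma>. \<rho> \<in> Sym n \<Longrightarrow> \<sigma> \<in> Sym n \<Longrightarrow> g (\<rho> \<circ> \<sigma> \<circ> inv \<rho>) = g \<sigma>"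
  shows "(\<Sum>\<sigma>\<in>Sym n. of_nat (f \<sigma>) * g \<sigma>) / fact n =
    (\<Sum>\<delta> | is_partition n \<delta>. 1 / of_nat (zee n \<delta>) * of_nat (class_value n f \<delta>) * class_value n g \<delta>)"
proof -
  let ?P = "{\<delta>. is_partition n \<delta>}"
  let ?C = "\<lambda>\<delta>. cycle_class {1..n} (mset \<delta>)"
  have le: "\<forall>r\<in>set \<delta>. 1 \<le> r \<and> r \<le> n" if "\<delta> \<in> ?P" for \<delta>
    using that by (auto simp: is_partition_def Suc_le_eq dest: member_le_sum_list)
  have card: "card (?C \<delta>) * zee n \<delta> = fact n" if "\<delta> \<in> ?P" for \<delta>
    using card_cycle_class[of "{1..n}" \<delta> n] le[OF that] that by (simp add: is_partition_def)
  have finP: "finite ?P"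
  proof (rule finite_subset)
    show "?P \<subseteq> {\<delta>. set \<delta> \<subseteq> {1..n} \<and> length \<delta> \<le> n}"
    proof
      fix \<delta> assume \<delta>: "\<delta> \<in> ?P"
      have "length \<delta> = sum_list (map (\<lambda>_. 1) \<delta>)"
        by (simp add: sum_list_triv)
      also have "\<dots> \<le> sum_list (map id \<delta>)"
        using le[OF \<delta>] by (intro sum_list_mono) auto
      finally show "\<delta> \<in> {\<delta>. set \<delta> \<subseteq> {1..n} \<and> length \<delta> \<le> n}"
        using le[OF \<delta>] \<delta> by (auto simp: is_partition_def)
    qed
    show "finite {\<delta>. set \<delta> \<subseteq> {1..n} \<and> length \<delta> \<le> n}"
      by (rule finite_lists_length_le) simp
  qed
  have "Sym n = (\<Union>\<delta>\<in>?P. ?C \<delta>)"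
  proof
    show "Sym n \<subseteq> (\<Union>\<delta>\<in>?P. ?C \<delta>)"
    proof
      fix \<sigma> assume "\<sigma> \<in> Sym n"
      then obtain \<delta> where "is_partition n \<delta>" "\<sigma> \<in> ?C \<delta>"
        by (rule partition_of_permutation)
      then show "\<sigma> \<in> (\<Union>\<delta>\<in>?P. ?C \<delta>)"
        by blast
    qed
    show "(\<Union>\<delta>\<in>?P. ?C \<delta>) \<subseteq> Sym n"
      by (auto simp: cycle_class_def Sym_def)
  qed
  then have "(\<Sum>\<sigma>\<in>Sym n. of_nat (f \<sigma>) * g \<sigma>) = (\<Sum>\<delta>\<in>?P. \<Sum>\<sigma>\<in>?C \<delta>. of_nat (f \<sigma>) * g \<sigma>)"
    by (simp only:, intro sum.UNION_disjoint ballI impI finP finite_cycle_class)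
      (auto simp: cycle_class_def dest: mset_partition_inject)
  also have "\<dots> = (\<Sum>\<delta>\<in>?P. of_nat (card (?C \<delta>)) * (of_nat (class_value n f \<delta>) * class_value n g \<delta>))"
  proof (rule sum.cong)
    fix \<delta> assume "\<delta> \<in> ?P"
    then have "class_value n f \<delta> = f \<sigma>" "class_value n g \<delta> = g \<sigma>" if "\<sigma> \<in> ?C \<delta>" for \<sigma>
      using class_value_eq[OF that] f g by blast+
    then have "(\<Sum>\<sigma>\<in>?C \<delta>. of_nat (f \<sigma>) * g \<sigma>) = (\<Sum>\<sigma>\<in>?C \<delta>. of_nat (class_value n f \<delta>) * class_value n g \<delta>)"
      by (intro sum.cong) auto
    then show "(\<Sum>\<sigma>\<in>?C \<delta>. of_nat (f \<sigma>) * g \<sigma>) = of_nat (card (?C \<delta>)) * (of_nat (class_value n f \<delta>) * class_value n g \<delta>)"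
      by simp
  qed simp
  also have "\<dots> / fact n = (\<Sum>\<delta>\<in>?P. 1 / of_nat (zee n \<delta>) * of_nat (class_value n f \<delta>) * class_value n g \<delta>)"
    unfolding sum_divide_distrib
  proof (rule sum.cong)
    fix \<delta> assume "\<delta> \<in> ?P"
    then have "(of_nat (card (?C \<delta>)) * of_nat (zee n \<delta>) :: 'f) = fact n"
      using card by (metis of_nat_fact of_nat_mult)
    moreover from this have "of_nat (zee n \<delta>) \<noteq> (0 :: 'f)"
      by (metis fact_nonzero mult_zero_right)
    ultimately have "of_nat (card (?C \<delta>)) / fact n = 1 / (of_nat (zee n \<delta>) :: 'f)"
      by (simp add: frac_eq_eq)
    then show "of_nat (card (?C \<delta>)) * (of_nat (class_value n f \<delta>) * class_value n g \<delta>) / fact n =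
        1 / of_nat (zee n \<delta>) * of_nat (class_value n f \<delta>) * class_value n g \<delta>"
      by (metis (no_types, lifting) mult.assoc times_divide_eq_left)
  qed simp
  finally show ?thesis .
qed

section \<open>The character formula\<close>

lemma fixpts_inv:
  assumes "\<sigma> \<in> Sym n"
  shows "fixpts n (inv \<sigma> ^^ m) = fixpts n (\<sigma> ^^ m)"
proof -
  have perm: "(\<sigma> ^^ m) permutes {1..n}"
    using assms by (simp add: Sym_def permutes_funpow)
  have "inv \<sigma> ^^ m = inv (\<sigma> ^^ m)"
    using assms by (simp add: Sym_def permutes_bij inv_fn)
  moreover have "inv (\<sigma> ^^ m) i = i \<longleftrightarrow> (\<sigma> ^^ m) i = i" for i
    using permutes_inverses[OF perm] by metis
  ultimately show ?thesis
    by (simp add: fixpts_def)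
qed

lemma fixpts_conjugate:
  assumes \<rho>: "\<rho> \<in> Sym n"
  shows "fixpts n ((\<rho> \<circ> \<sigma> \<circ> inv \<rho>) ^^ m) = fixpts n (\<sigma> ^^ m)"
proof -
  have pow: "((\<rho> \<circ> \<sigma> \<circ> inv \<rho>) ^^ m) x = \<rho> ((\<sigma> ^^ m) (inv \<rho> x))" for x
    by (induction m) (simp_all add: Sym_inverses[OF \<rho>])
  have "{i \<in> {1..n}. (\<sigma> ^^ m) i = i} = inv \<rho> ` {i \<in> {1..n}. ((\<rho> \<circ> \<sigma> \<circ> inv \<rho>) ^^ m) i = i}"
  proof
    show "{i \<in> {1..n}. (\<sigma> ^^ m) i = i} \<subseteq> inv \<rho> ` {i \<in> {1..n}. ((\<rho> \<circ> \<sigma> \<circ> inv \<rho>) ^^ m) i = i}"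
    proof
      fix i assume i: "i \<in> {i \<in> {1..n}. (\<sigma> ^^ m) i = i}"
      then have "\<rho> i \<in> {1..n}"
        using Sym_image[OF \<rho>] by blast
      with i show "i \<in> inv \<rho> ` {i \<in> {1..n}. ((\<rho> \<circ> \<sigma> \<circ> inv \<rho>) ^^ m) i = i}"
        by (intro image_eqI[of _ _ "\<rho> i"]) (simp_all add: pow Sym_inverses[OF \<rho>])
    qed
    show "inv \<rho> ` {i \<in> {1..n}. ((\<rho> \<circ> \<sigma> \<circ> inv \<rho>) ^^ m) i = i} \<subseteq> {i \<in> {1..n}. (\<sigma> ^^ m) i = i}"
    proof (rule image_subsetI)
      fix i assume i: "i \<in> {i \<in> {1..n}. ((\<rho> \<circ> \<sigma> \<circ> inv \<rho>) ^^ m) i = i}"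
      then have "inv \<rho> i \<in> {1..n}"
        using Sym_image[OF Sym_inv[OF \<rho>]] by blast
      moreover have "\<rho> ((\<sigma> ^^ m) (inv \<rho> i)) = i"
        using i pow by simp
      then have "(\<sigma> ^^ m) (inv \<rho> i) = inv \<rho> i"
        using Sym_inverses(2)[OF \<rho>] by metis
      ultimately show "inv \<rho> i \<in> {i \<in> {1..n}. (\<sigma> ^^ m) i = i}"
        by simp
    qed
  qed
  moreover have "inj (inv \<rho>)"
    using Sym_inv[OF \<rho>] by (simp add: Sym_def permutes_inj)
  ultimately show ?thesis
    unfolding fixpts_def by (simp add: card_image inj_on_subset)
qed

lemma sum_Sym_inv: "(\<Sum>\<sigma>\<in>Sym n. h (inv \<sigma>)) = (\<Sum>\<sigma>\<in>Sym n. h \<sigma>)"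
  by (rule sum.reindex_bij_witness[where i = inv and j = inv]) (auto simp: Sym_inv Sym_inverses)

theorem theorem4p17:
  fixes k n l :: nat and lam mu :: "nat list"
  assumes "k \<ge> 1" and "n \<ge> 1" and "n \<ge> 2 * k"
    and "lam \<in> Lambda TYPE('f::field_char_0) n k"
    and "l \<le> k" and "is_partition l mu"
  shows "(xi n k lam (dgm (gamma_dgm k mu)) :: 'f)
           = of_nat n ^ (k - l) / fact n
               * (\<Sum>\<sigma>\<in>Sym n. of_nat (fixpts_part n mu \<sigma>) * chi n lam (inv \<sigma>))
       \<and> of_nat n ^ (k - l) / fact n
               * (\<Sum>\<sigma>\<in>Sym n. of_nat (fixpts_part n mu \<sigma>) * (chi n lam (inv \<sigma>) :: 'f))
           = of_nat n ^ (k - l) / fact n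
               * (\<Sum>\<sigma>\<in>Sym n. of_nat (fixpts_part n mu \<sigma>) * chi n lam \<sigma>)
       \<and> of_nat n ^ (k - l) / fact n
               * (\<Sum>\<sigma>\<in>Sym n. of_nat (fixpts_part n mu \<sigma>) * (chi n lam \<sigma> :: 'f))
           = of_nat n ^ (k - l)
               * (\<Sum>\<delta> | is_partition n \<delta>. 1 / of_nat (zee n \<delta>)
                    * of_nat (class_value n (fixpts_part n mu) \<delta>) * class_value n (chi n lam) \<delta>)"
proof (intro conjI)
  let ?F = "fixpts_part n mu"
  have "(xi n k lam (dgm (gamma_dgm k mu)) :: 'f) =
      (\<Sum>\<sigma>\<in>Sym n. of_nat n ^ (k - l) * (of_nat (?F \<sigma>) * chi n lam (inv \<sigma>))) / fact n"
    unfolding xi_dgm[OF card_twisted_fixed_words_gamma(1)[OF assms(6,5)]]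
    by (simp add: card_twisted_fixed_words_gamma(2)[OF assms(6,5)] mult.assoc cong: sum.cong)
  then show "(xi n k lam (dgm (gamma_dgm k mu)) :: 'f) =
      of_nat n ^ (k - l) / fact n * (\<Sum>\<sigma>\<in>Sym n. of_nat (?F \<sigma>) * chi n lam (inv \<sigma>))"
    by (simp add: sum_distrib_left[symmetric])
  have "?F (inv \<sigma>) = ?F \<sigma>" if "\<sigma> \<in> Sym n" for \<sigma>
    using that by (simp add: fixpts_part_def fixpts_inv)
  then have "(\<Sum>\<sigma>\<in>Sym n. of_nat (?F \<sigma>) * (chi n lam (inv \<sigma>) :: 'f)) =
      (\<Sum>\<sigma>\<in>Sym n. of_nat (?F (inv \<sigma>)) * chi n lam (inv \<sigma>))"
    by (intro sum.cong) auto
  also have "\<dots> = (\<Sum>\<sigma>\<in>Sym n. of_nat (?F \<sigma>) * chi n lam \<sigma>)"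
    by (rule sum_Sym_inv)
  finally show "of_nat n ^ (k - l) / fact n
        * (\<Sum>\<sigma>\<in>Sym n. of_nat (?F \<sigma>) * (chi n lam (inv \<sigma>) :: 'f))
      = of_nat n ^ (k - l) / fact n * (\<Sum>\<sigma>\<in>Sym n. of_nat (?F \<sigma>) * chi n lam \<sigma>)"
    by simp
  have "(\<Sum>\<sigma>\<in>Sym n. of_nat (?F \<sigma>) * (chi n lam \<sigma> :: 'f)) / fact n =
      (\<Sum>\<delta> | is_partition n \<delta>. 1 / of_nat (zee n \<delta>) * of_nat (class_value n ?F \<delta>) * class_value n (chi n lam) \<delta>)"
    by (rule sum_class_functions) (simp_all add: fixpts_part_def fixpts_conjugate chi_conjugate)
  then show "of_nat n ^ (k - l) / fact n * (\<Sum>\<sigma>\<in>Sym n. of_nat (?F \<sigma>) * (chi n lam \<sigma> :: 'f))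
      = of_nat n ^ (k - l)
          * (\<Sum>\<delta> | is_partition n \<delta>. 1 / of_nat (zee n \<delta>)
               * of_nat (class_value n ?F \<delta>) * class_value n (chi n lam) \<delta>)"
    by (metis times_divide_eq_left times_divide_eq_right)
qed

end
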